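(* Let $\phi$ be a quantum channel (completely positive, trace-preserving linear map) acting on $d\times d$ complex matrices (system $A$, $d<\infty$). Then $\phi$ is universal entanglement-preserving if and only if $\phi$ is a unitary evolution, i.e. there is a unitary $U$ with $\phi(X)=UXU^\dagger$ for all $X$.
   Context: A channel $\phi$ on system $A$ is universal entanglement-preserving (UEP) if for every finite-dimensional quantum system $B$ and every entangled (non-separable) state $\rho_{AB}$ on $AB$, the state $(\phi\otimes I)(\rho_{AB})$ is again entangled, where $I$ is the identity map on $B$. *)

theory Defs
  imports "Jordan_Normal_Form.Matrix"
begin

text \<open>Matrices are Jordan_Normal_Form matrices over complex numbers.
  A bipartite system AB with dimensions dA, dB is represented by
  (dA*dB) x (dA*dB) matrices, where the row/column index i*dB + k
  corresponds to the basis vector e_i (x) f_k (Kronecker convention).\<close>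

definition adj :: "complex mat \<Rightarrow> complex mat" where
  "adj A = mat (dim_col A) (dim_row A) (\<lambda>(i,j). cnj (A $$ (j,i)))"

definition mtrace :: "complex mat \<Rightarrow> complex" where
  "mtrace A = (\<Sum>i<dim_row A. A $$ (i,i))"

definition psd :: "nat \<Rightarrow> complex mat \<Rightarrow> bool" where
  "psd n A \<longleftrightarrow> A \<in> carrier_mat n n \<and>
     (\<forall>v \<in> carrier_vec n. Im (conjugate v \<bullet> (A *\<^sub>v v)) = 0 \<and> Re (conjugate v \<bullet> (A *\<^sub>v v)) \<ge> 0)"

definition density :: "nat \<Rightarrow> complex mat \<Rightarrow> bool" where
  "density n \<rho> \<longleftrightarrow> psd n \<rho> \<and> mtrace \<rho> = 1"

definition kron :: "complex mat \<Rightarrow> complex mat \<Rightarrow> complex mat" where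
  "kron A B = mat (dim_row A * dim_row B) (dim_col A * dim_col B)
     (\<lambda>(r,c). A $$ (r div dim_row B, c div dim_col B) * B $$ (r mod dim_row B, c mod dim_col B))"

definition separable :: "nat \<Rightarrow> nat \<Rightarrow> complex mat \<Rightarrow> bool" where
  "separable dA dB \<rho> \<longleftrightarrow>
     (\<exists>(N::nat) (p::nat \<Rightarrow> real) \<sigma> \<tau>.
        (\<forall>k<N. p k \<ge> 0 \<and> density dA (\<sigma> k) \<and> density dB (\<tau> k)) \<and>
        (\<Sum>k<N. p k) = 1 \<and>
        \<rho> = mat (dA*dB) (dA*dB) (\<lambda>(r,c). \<Sum>k<N. complex_of_real (p k) * kron (\<sigma> k) (\<tau> k) $$ (r,c)))"

definition entangled :: "nat \<Rightarrow> nat \<Rightarrow> complex mat \<Rightarrow> bool" where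
  "entangled dA dB \<rho> \<longleftrightarrow> density (dA*dB) \<rho> \<and> \<not> separable dA dB \<rho>"

text \<open>(phi (x) id_B) applied to an operator rho on AB: phi acts on each dA x dA block
  rho_{kl} = (rho(i*dB+k, j*dB+l))_{i,j}, i.e. (phi (x) I)(rho) = sum_{k,l} phi(rho_{kl}) (x) |k><l|.\<close>
definition ext_id :: "(complex mat \<Rightarrow> complex mat) \<Rightarrow> nat \<Rightarrow> nat \<Rightarrow> complex mat \<Rightarrow> complex mat" where
  "ext_id \<phi> dA dB \<rho> = mat (dA*dB) (dA*dB)
     (\<lambda>(r,c). \<phi> (mat dA dA (\<lambda>(i,j). \<rho> $$ (i*dB + r mod dB, j*dB + c mod dB))) $$ (r div dB, c div dB))"

definition linear_map_on :: "nat \<Rightarrow> (complex mat \<Rightarrow> complex mat) \<Rightarrow> bool" where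
  "linear_map_on d \<phi> \<longleftrightarrow>
     (\<forall>X \<in> carrier_mat d d. \<phi> X \<in> carrier_mat d d) \<and>
     (\<forall>X \<in> carrier_mat d d. \<forall>Y \<in> carrier_mat d d. \<phi> (X + Y) = \<phi> X + \<phi> Y) \<and>
     (\<forall>X \<in> carrier_mat d d. \<forall>a::complex. \<phi> (a \<cdot>\<^sub>m X) = a \<cdot>\<^sub>m \<phi> X)"

definition completely_positive :: "nat \<Rightarrow> (complex mat \<Rightarrow> complex mat) \<Rightarrow> bool" where
  "completely_positive d \<phi> \<longleftrightarrow>
     (\<forall>n \<rho>. psd (d*n) \<rho> \<longrightarrow> psd (d*n) (ext_id \<phi> d n \<rho>))"

definition trace_preserving :: "nat \<Rightarrow> (complex mat \<Rightarrow> complex mat) \<Rightarrow> bool" where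
  "trace_preserving d \<phi> \<longleftrightarrow> (\<forall>X \<in> carrier_mat d d. mtrace (\<phi> X) = mtrace X)"

definition quantum_channel :: "nat \<Rightarrow> (complex mat \<Rightarrow> complex mat) \<Rightarrow> bool" where
  "quantum_channel d \<phi> \<longleftrightarrow> linear_map_on d \<phi> \<and> completely_positive d \<phi> \<and> trace_preserving d \<phi>"

definition UEP :: "nat \<Rightarrow> (complex mat \<Rightarrow> complex mat) \<Rightarrow> bool" where
  "UEP d \<phi> \<longleftrightarrow> (\<forall>dB \<rho>. entangled d dB \<rho> \<longrightarrow> entangled d dB (ext_id \<phi> d dB \<rho>))"

definition unitary :: "nat \<Rightarrow> complex mat \<Rightarrow> bool" where
  "unitary d U \<longleftrightarrow> U \<in> carrier_mat d d \<and> adj U * U = 1\<^sub>m d"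

end

theory Submission
  imports Defs "Jordan_Normal_Form.Determinant"
begin

text \<open>Let \<open>\<phi>\<close> be entanglement-preserving. If \<open>u\<close> is orthogonal to vectors \<open>w\<^sub>m\<close>, not all zero, and
  \<open>P = \<Sum> w\<^sub>m w\<^sub>m\<^sup>*\<close>, then \<open>\<phi>(P)\<close> cannot dominate a positive multiple of \<open>\<phi>(u u\<^sup>*)\<close>: otherwise a
  weakly entangled state of \<open>A\<close> with a qubit, whose entanglement rests on \<open>P u = 0\<close>, would be
  mapped to a separable one. Hence some \<open>v\<close> has \<open>v\<^sup>* \<phi>(w\<^sub>m w\<^sub>m\<^sup>*) v = 0\<close> for all \<open>m\<close> but
  \<open>v\<^sup>* \<phi>(u u\<^sup>*) v \<noteq> 0\<close>. With \<open>u = e\<^sub>j\<close> and the other basis vectors as \<open>w\<^sub>m\<close> this gives a basis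
  \<open>v\<^sub>j\<close> in which the Choi form of \<open>\<phi>\<close> is supported on the vectors \<open>v\<^sub>j \<otimes> e\<^sub>j\<close>; with \<open>u = \<Sum> e\<^sub>k\<close> and
  \<open>w\<^sub>m = e\<^sub>0 - e\<^sub>m\<close> it forces that \<open>d \<times> d\<close> block to have rank one, so \<open>\<phi>(X) = K X K\<^sup>*\<close>, and
  trace preservation makes \<open>K\<close> unitary. Conversely, for \<open>\<phi>(X) = U X U\<^sup>*\<close>, conjugation with \<open>U\<^sup>*\<close>
  carries separable decompositions of the image back to the original state.\<close>

section \<open>Positive semidefinite forms\<close>

text \<open>Forms live on all functions \<open>nat \<Rightarrow> complex\<close>, so induction on
  the dimension only changes a support condition on vectors. Conjugate linearity in the first
  argument follows from Hermitian symmetry.\<close>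

definition psd_form :: "((nat \<Rightarrow> complex) \<Rightarrow> (nat \<Rightarrow> complex) \<Rightarrow> complex) \<Rightarrow> bool" where
  "psd_form B \<longleftrightarrow>
     (\<forall>x y z. B x (\<lambda>i. y i + z i) = B x y + B x z) \<and>
     (\<forall>x c y. B x (\<lambda>i. c * y i) = c * B x y) \<and>
     (\<forall>x y. B y x = cnj (B x y)) \<and>
     (\<forall>x. 0 \<le> Re (B x x))"

context
  fixes B :: "(nat \<Rightarrow> complex) \<Rightarrow> (nat \<Rightarrow> complex) \<Rightarrow> complex"
  assumes B: "psd_form B"
begin

lemma psd_form_add_right: "B x (\<lambda>i. y i + z i) = B x y + B x z"
  and psd_form_scale_right: "B x (\<lambda>i. c * y i) = c * B x y"
  and psd_form_herm: "B y x = cnj (B x y)"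
  and psd_form_nonneg: "0 \<le> Re (B x x)"
  using B unfolding psd_form_def by blast+

lemma psd_form_add_left: "B (\<lambda>i. y i + z i) x = B y x + B z x"
  by (metis complex_cnj_add psd_form_add_right psd_form_herm)

lemma psd_form_scale_left: "B (\<lambda>i. c * y i) x = cnj c * B y x"
  by (metis complex_cnj_mult psd_form_scale_right psd_form_herm)

lemma psd_form_real: "Im (B x x) = 0"
  using psd_form_herm[of x x] by (metis Reals_cnj_iff complex_is_Real_iff)

lemma psd_form_eq_Re: "B x x = of_real (Re (B x x))"
  by (simp add: complex_eq_iff psd_form_real)

lemma psd_form_expand:
  "B (\<lambda>i. x i + c * y i) (\<lambda>i. x i + c * y i)
   = B x x + c * B x y + cnj c * B y x + of_real ((cmod c)\<^sup>2) * B y y"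
  unfolding psd_form_add_right psd_form_add_left psd_form_scale_left psd_form_scale_right
  by (simp add: complex_norm_square algebra_simps flip: of_real_power)

text \<open>A null vector lies in the radical: along the line \<open>y + c x\<close> the quadratic
  term is absent, so a nonzero linear term would drive the value below zero.\<close>

lemma psd_form_null_right:
  assumes "B x x = 0"
  shows "B y x = 0"
proof (rule ccontr)
  assume "B y x \<noteq> 0"
  define b where "b = Re (B y y)"
  define n where "n = (cmod (B y x))\<^sup>2"
  have n: "n > 0" using \<open>B y x \<noteq> 0\<close> by (simp add: n_def)
  \<comment> \<open>Chosen so that the value \<open>b - 2 * s * n\<close> below equals -1.\<close>
  define s where "s = (b + 1) / (2 * n)"
  define c where "c = - of_real s * cnj (B y x)"
  have "0 \<le> Re (B (\<lambda>i. y i + c * x i) (\<lambda>i. y i + c * x i))" by (rule psd_form_nonneg)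
  also have "\<dots> = b - 2 * s * n"
  proof -
    have h: "B x y = cnj (B y x)" by (rule psd_form_herm)
    show ?thesis
      unfolding psd_form_expand assms h c_def b_def n_def
      unfolding power2_eq_square[symmetric] cmod_power2
      by (simp add: power2_eq_square algebra_simps norm_mult)
  qed
  also have "\<dots> = -1" using n by (simp add: s_def field_simps)
  finally show False by simp
qed

lemma psd_form_null_left: "B x x = 0 \<Longrightarrow> B x y = 0"
  using psd_form_null_right psd_form_herm by (metis complex_cnj_zero)

text \<open>Parallelogram law, with the nonnegative value at \<open>x - c y\<close> dropped.\<close>

lemma psd_form_add_bound:
  "Re (B (\<lambda>i. x i + c * y i) (\<lambda>i. x i + c * y i)) \<le> 2 * Re (B x x) + 2 * (cmod c)\<^sup>2 * Re (B y y)"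
proof -
  have "0 \<le> Re (B (\<lambda>i. x i + (-c) * y i) (\<lambda>i. x i + (-c) * y i))" by (rule psd_form_nonneg)
  then show ?thesis unfolding psd_form_expand by (simp add: algebra_simps)
qed

text \<open>Pullback along a linear map; used for the projection \<open>pr\<close> below and for
  \<open>v\<close> mapped to \<open>tens d v x\<close>.\<close>

lemma psd_form_comp:
  assumes "\<And>x y. f (\<lambda>i. x i + y i) = (\<lambda>i. f x i + f y i)"
    and "\<And>c x. f (\<lambda>i. c * x i) = (\<lambda>i. c * f x i)"
  shows "psd_form (\<lambda>x y. B (f x) (f y))"
  unfolding psd_form_def assms
  using psd_form_add_right psd_form_scale_right psd_form_herm psd_form_nonneg by blast

end

section \<open>Finite sums and domination of positive forms\<close>

lemma psd_form_sum_right: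
  assumes B: "psd_form B" and "finite I"
  shows "B x (\<lambda>i. \<Sum>a\<in>I. c a * y a i) = (\<Sum>a\<in>I. c a * B x (y a))"
  using assms(2)
proof (induction I rule: finite_induct)
  case empty
  show ?case using psd_form_scale_right[OF B, of x 0 "\<lambda>_. 0"] by simp
next
  case (insert a I)
  then have "B x (\<lambda>i. \<Sum>a\<in>insert a I. c a * y a i) = B x (\<lambda>i. c a * y a i + (\<Sum>a\<in>I. c a * y a i))"
    by simp
  also have "\<dots> = (\<Sum>a\<in>insert a I. c a * B x (y a))"
    unfolding psd_form_add_right[OF B] psd_form_scale_right[OF B] insert.IH
    using insert.hyps by simp
  finally show ?case .
qed

lemma psd_form_sum_left:
  assumes B: "psd_form B" and I: "finite I"
  shows "B (\<lambda>i. \<Sum>a\<in>I. c a * y a i) x = (\<Sum>a\<in>I. cnj (c a) * B (y a) x)"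
proof -
  have "B (\<lambda>i. \<Sum>a\<in>I. c a * y a i) x = cnj (B x (\<lambda>i. \<Sum>a\<in>I. c a * y a i))"
    by (rule psd_form_herm[OF B])
  also have "\<dots> = (\<Sum>a\<in>I. cnj (c a) * cnj (B x (y a)))"
    by (simp add: psd_form_sum_right[OF assms] cnj_sum)
  also have "\<dots> = (\<Sum>a\<in>I. cnj (c a) * B (y a) x)"
    by (intro sum.cong refl arg_cong2[where f="(*)"] psd_form_herm[OF B, symmetric])
  finally show ?thesis .
qed

lemma psd_form_sum:
  assumes B: "\<And>m. m \<in> I \<Longrightarrow> psd_form (B m)"
  shows "psd_form (\<lambda>x y. \<Sum>m\<in>I. B m x y)"
  unfolding psd_form_def
proof (intro conjI allI)
  fix x y
  show "(\<Sum>m\<in>I. B m y x) = cnj (\<Sum>m\<in>I. B m x y)"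
    unfolding cnj_sum by (intro sum.cong refl psd_form_herm B)
qed (use B in \<open>simp_all add: psd_form_add_right psd_form_scale_right psd_form_nonneg sum.distrib
  sum_distrib_left Re_sum sum_nonneg\<close>)

text \<open>The proof splits off the last coordinate vector \<open>u\<close> and, if
  \<open>u\<close> is not null for \<open>B\<close>, projects along it. The forms vary in the
  induction because they are replaced by their pullbacks under this projection.\<close>

lemma psd_form_dominated:
  assumes "psd_form B" "psd_form C"
    and "\<And>x. B x x = 0 \<Longrightarrow> C x x = 0"
  shows "\<exists>c\<ge>0. \<forall>x. (\<forall>i\<ge>n. x i = 0) \<longrightarrow> Re (C x x) \<le> c * Re (B x x)"
  using assms
proof (induction n arbitrary: B C)
  case 0
  have "C x x = 0" if "\<forall>i\<ge>0. x i = 0" for x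
  proof -
    have "x = (\<lambda>i. 0 * x i)" using that by auto
    then show ?thesis using psd_form_scale_right[OF "0.prems"(2), of x 0 x] by simp
  qed
  then show ?case by (intro exI[of _ 0]) auto
next
  case (Suc n)
  note B = Suc.prems(1) and C = Suc.prems(2) and BC = Suc.prems(3)
  define u :: "nat \<Rightarrow> complex" where "u = (\<lambda>i. if i = n then 1 else 0)"
  have split: "x = (\<lambda>i. (x(n := 0)) i + x n * u i)" for x by (auto simp: u_def)
  show ?case
  proof (cases "B u u = 0")
    case True
    \<comment> \<open>Here \<open>u\<close> is null for \<open>B\<close>, hence for
      \<open>C\<close>, so both forms ignore coordinate \<open>n\<close>.\<close>
    obtain c where c: "c \<ge> 0" "\<And>x. \<forall>i\<ge>n. x i = 0 \<Longrightarrow> Re (C x x) \<le> c * Re (B x x)"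
      using Suc.IH[OF B C BC] by blast
    have red: "D x x = D (x(n := 0)) (x(n := 0))" if D: "psd_form D" "D u u = 0" for D x
    proof -
      have "D x x = D (\<lambda>i. (x(n := 0)) i + x n * u i) (\<lambda>i. (x(n := 0)) i + x n * u i)"
        by (rule arg_cong2[OF split split])
      also have "\<dots> = D (x(n := 0)) (x(n := 0))"
        unfolding psd_form_expand[OF D(1)]
        using psd_form_null_left[OF D] psd_form_null_right[OF D] by (simp add: D(2) fun_upd_def)
      finally show ?thesis .
    qed
    have "Re (C x x) \<le> c * Re (B x x)" if x: "\<forall>i\<ge>Suc n. x i = 0" for x
    proof -
      have "\<forall>i\<ge>n. (x(n := 0)) i = 0" using x by (auto simp: Suc_le_eq)
      from c(2)[OF this] show ?thesis
        using red[OF B True, of x] red[OF C BC[OF True], of x] by simp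
    qed
    with c(1) show ?thesis by blast
  next
    case False
    define b where "b = Re (B u u)"
    have Bu: "B u u = of_real b" unfolding b_def by (rule psd_form_eq_Re[OF B])
    have b: "b > 0" 
    proof -
      have "b \<noteq> 0" using False Bu by auto
      moreover have "0 \<le> b" unfolding b_def by (rule psd_form_nonneg[OF B])
      ultimately show ?thesis by simp
    qed
    \<comment> \<open>\<open>al x * u\<close> is the \<open>B\<close>-orthogonal projection of
      \<open>x\<close> onto \<open>u\<close>, and \<open>pr x\<close> is the remainder.\<close>
    define al where "al = (\<lambda>x. B u x / B u u)"
    define pr where "pr = (\<lambda>x i. x i - al x * u i)"
    have pr_add: "pr (\<lambda>i. x i + y i) = (\<lambda>i. pr x i + pr y i)" for x y
      by (auto simp: pr_def al_def psd_form_add_right[OF B] algebra_simps add_divide_distrib)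
    have pr_scale: "pr (\<lambda>i. c * x i) = (\<lambda>i. c * pr x i)" for c x
      by (auto simp: pr_def al_def psd_form_scale_right[OF B] algebra_simps)
    have pr_u: "pr u = (\<lambda>i. 0)" using False by (auto simp: pr_def al_def)
    \<comment> \<open>Since \<open>pr\<close> kills \<open>u\<close>, coordinate \<open>n\<close>
      may be cleared first; this puts every \<open>x\<close> within reach of the induction
      hypothesis for the pulled-back forms.\<close>
    have pr_upd: "pr x = pr (x(n := 0))" for x
    proof -
      have "pr x = pr (\<lambda>i. (x(n := 0)) i + x n * u i)"
        by (rule arg_cong[OF split])
      then show ?thesis unfolding pr_add pr_scale pr_u by (simp add: fun_upd_def)
    qed
    have dec: "x = (\<lambda>i. pr x i + al x * u i)" for x by (auto simp: pr_def)
    have Bupr: "B u (pr x) = 0" for x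
    proof -
      have "B u x = B u (\<lambda>i. pr x i + al x * u i)"
        by (rule arg_cong[OF dec])
      also have "\<dots> = B u (pr x) + al x * B u u"
        by (simp only: psd_form_add_right[OF B] psd_form_scale_right[OF B])
      finally have "B u x = B u (pr x) + al x * B u u" .
      then show ?thesis using False by (simp add: al_def)
    qed
    have Bx: "Re (B x x) = Re (B (pr x) (pr x)) + (cmod (al x))\<^sup>2 * b" for x
    proof -
      have "B (pr x) u = 0" using Bupr psd_form_herm[OF B] by (metis complex_cnj_zero)
      moreover have "B x x = B (\<lambda>i. pr x i + al x * u i) (\<lambda>i. pr x i + al x * u i)"
        by (rule arg_cong2[OF dec dec])
      ultimately have "B x x
          = B (pr x) (pr x) + of_real ((cmod (al x))\<^sup>2) * B u u"
        unfolding psd_form_expand[OF B] Bupr by simp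
      then show ?thesis using Bu by simp
    qed
    have "\<exists>c\<ge>0. \<forall>x. (\<forall>i\<ge>n. x i = 0) \<longrightarrow>
        Re (C (pr x) (pr x)) \<le> c * Re (B (pr x) (pr x))"
      by (rule Suc.IH[of "\<lambda>x y. B (pr x) (pr y)" "\<lambda>x y. C (pr x) (pr y)"])
        (use psd_form_comp[OF B, of pr] psd_form_comp[OF C, of pr] pr_add pr_scale BC in auto)
    then obtain c where c: "c \<ge> 0"
      "\<And>x. \<forall>i\<ge>n. x i = 0 \<Longrightarrow> Re (C (pr x) (pr x)) \<le> c * Re (B (pr x) (pr x))"
      by blast
    \<comment> \<open>The factors 2 come from \<open>psd_form_add_bound\<close>; the summands pay
      for \<open>pr x\<close> and for the component along \<open>u\<close>, whose
      \<open>B\<close>-values add up by \<open>Bx\<close>.\<close>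
    define c' where "c' = 2 * c + 2 * Re (C u u) / b"
    have Cu: "0 \<le> Re (C u u)" by (rule psd_form_nonneg[OF C])
    have c': "c' \<ge> 0" using c(1) Cu b by (simp add: c'_def)
    have "Re (C x x) \<le> c' * Re (B x x)" if x: "\<forall>i\<ge>Suc n. x i = 0" for x
    proof -
      have "\<forall>i\<ge>n. (x(n := 0)) i = 0" using x by (auto simp: Suc_le_eq)
      then have 1: "Re (C (pr x) (pr x)) \<le> c * Re (B (pr x) (pr x))"
        unfolding pr_upd[of x] by (rule c(2))
      have "Re (C x x) = Re (C (\<lambda>i. pr x i + al x * u i) (\<lambda>i. pr x i + al x * u i))"
        by (rule arg_cong[OF arg_cong2[OF dec dec]])
      also have "\<dots> \<le> 2 * Re (C (pr x) (pr x)) + 2 * (cmod (al x))\<^sup>2 * Re (C u u)"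
        by (rule psd_form_add_bound[OF C])
      also have "\<dots> \<le> 2 * c * Re (B (pr x) (pr x)) + 2 * Re (C u u) / b * ((cmod (al x))\<^sup>2 * b)"
        using 1 b by simp
      also have "\<dots> \<le> c' * Re (B (pr x) (pr x)) + c' * ((cmod (al x))\<^sup>2 * b)"
        using c(1) Cu b psd_form_nonneg[OF B, of "pr x"]
        by (intro add_mono mult_right_mono) (auto simp: c'_def)
      also have "\<dots> = c' * Re (B x x)" unfolding Bx[of x] by (simp add: algebra_simps)
      finally show ?thesis .
    qed
    with c' show ?thesis by blast
  qed
qed

section \<open>Forms given by finite matrices of coefficients\<close>

definition quad :: "nat \<Rightarrow> (nat \<Rightarrow> nat \<Rightarrow> complex) \<Rightarrow> (nat \<Rightarrow> complex) \<Rightarrow> (nat \<Rightarrow> complex) \<Rightarrow> complex" where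
  "quad n a x y = (\<Sum>i<n. \<Sum>j<n. cnj (x i) * a i j * y j)"

text \<open>Matrices are treated as entry functions, which keeps sums, multiples and outer products
  free of carrier conditions.\<close>

definition psd_kernel :: "nat \<Rightarrow> (nat \<Rightarrow> nat \<Rightarrow> complex) \<Rightarrow> bool" where
  "psd_kernel n a \<longleftrightarrow> (\<forall>x. Im (quad n a x x) = 0 \<and> 0 \<le> Re (quad n a x x))"

lemma quad_cong:
  assumes "\<And>i j. i < n \<Longrightarrow> j < n \<Longrightarrow> a i j = b i j"
    and "\<And>i. i < n \<Longrightarrow> x i = x' i" "\<And>i. i < n \<Longrightarrow> y i = y' i"
  shows "quad n a x y = quad n b x' y'"
  unfolding quad_def using assms by simp

lemma psd_kernel_cong:
  assumes "\<And>i j. i < n \<Longrightarrow> j < n \<Longrightarrow> a i j = b i j"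
  shows "psd_kernel n a = psd_kernel n b"
proof -
  have "quad n a x x = quad n b x x" for x by (rule quad_cong) (auto simp: assms)
  then show ?thesis by (simp add: psd_kernel_def)
qed

lemma quad_add_right: "quad n a x (\<lambda>i. y i + z i) = quad n a x y + quad n a x z"
  and quad_add_left: "quad n a (\<lambda>i. y i + z i) x = quad n a y x + quad n a z x"
  and quad_scale_right: "quad n a x (\<lambda>i. c * y i) = c * quad n a x y"
  and quad_scale_left: "quad n a (\<lambda>i. c * y i) x = cnj c * quad n a y x"
  by (simp_all add: quad_def sum.distrib sum_distrib_left algebra_simps)

lemma quad_add: "quad n (\<lambda>i j. a i j + b i j) x y = quad n a x y + quad n b x y"
  and quad_scale: "quad n (\<lambda>i j. c * a i j) x y = c * quad n a x y"
  by (simp_all add: quad_def sum.distrib sum_distrib_left algebra_simps)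

lemma quad_sum: "quad n (\<lambda>i j. \<Sum>m\<in>I. a m i j) x y = (\<Sum>m\<in>I. quad n (a m) x y)"
proof -
  have "(\<Sum>m\<in>I. \<Sum>i<n. \<Sum>j<n. cnj (x i) * a m i j * y j)
      = (\<Sum>i<n. \<Sum>m\<in>I. \<Sum>j<n. cnj (x i) * a m i j * y j)" by (rule sum.swap)
  also have "\<dots> = (\<Sum>i<n. \<Sum>j<n. \<Sum>m\<in>I. cnj (x i) * a m i j * y j)"
    by (intro sum.cong refl sum.swap)
  finally show ?thesis by (simp add: quad_def sum_distrib_left sum_distrib_right)
qed

lemma quad_outer:
  "quad n (\<lambda>i j. f i * cnj (g j)) x y = (\<Sum>i<n. cnj (x i) * f i) * cnj (\<Sum>j<n. cnj (y j) * g j)"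
  by (simp add: quad_def sum_product cnj_sum algebra_simps)

lemma psd_kernel_outer: "psd_kernel n (\<lambda>i j. f i * cnj (f j))"
  unfolding psd_kernel_def quad_outer complex_norm_square[symmetric]
  by (simp del: of_real_power)

lemma psd_kernel_add: "psd_kernel n a \<Longrightarrow> psd_kernel n b \<Longrightarrow> psd_kernel n (\<lambda>i j. a i j + b i j)"
  by (simp add: psd_kernel_def quad_add)

lemma psd_kernel_scale: "psd_kernel n a \<Longrightarrow> 0 \<le> s \<Longrightarrow> psd_kernel n (\<lambda>i j. of_real s * a i j)"
  by (simp add: psd_kernel_def quad_scale)

lemma psd_kernel_sum: "(\<And>m. m \<in> I \<Longrightarrow> psd_kernel n (a m)) \<Longrightarrow> psd_kernel n (\<lambda>i j. \<Sum>m\<in>I. a m i j)"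
  by (simp add: psd_kernel_def quad_sum Re_sum Im_sum sum_nonneg)

text \<open>Hermitian symmetry comes by polarisation: the values at \<open>x + y\<close> and
  \<open>x + \<i> y\<close> are real.\<close>

lemma psd_form_quad:
  assumes "psd_kernel n a"
  shows "psd_form (quad n a)"
proof -
  have "quad n a y x = cnj (quad n a x y)" for x y
  proof -
    have re: "Im (quad n a z z) = 0" for z using assms by (simp add: psd_kernel_def)
    have "quad n a (\<lambda>i. x i + c * y i) (\<lambda>i. x i + c * y i)
      = quad n a x x + c * quad n a x y + cnj c * quad n a y x + c * cnj c * quad n a y y" for c
      unfolding quad_add_right quad_add_left quad_scale_left quad_scale_right
      by (simp add: algebra_simps)
    from this[of 1] this[of \<i>] have "Im (quad n a x y) + Im (quad n a y x) = 0"
      "Re (quad n a x y) - Re (quad n a y x) = 0"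
      using re[of x] re[of y] re[of "\<lambda>i. x i + 1 * y i"] re[of "\<lambda>i. x i + \<i> * y i"]
      by simp_all
    then show ?thesis by (simp add: complex_eq_iff)
  qed
  moreover have "0 \<le> Re (quad n a x x)" for x using assms by (simp add: psd_kernel_def)
  ultimately show ?thesis
    unfolding psd_form_def using quad_add_right quad_scale_right by blast
qed

lemma scalar_prod_mult_mat_vec_quad:
  assumes "A \<in> carrier_mat n n"
  shows "conjugate (vec n x) \<bullet> (A *\<^sub>v vec n y) = quad n (\<lambda>i j. A $$ (i,j)) x y"
  using assms
  by (auto simp: scalar_prod_def quad_def sum_distrib_left mult.assoc atLeast0LessThan
      intro!: sum.cong)

lemma psd_iff: "psd n A \<longleftrightarrow> A \<in> carrier_mat n n \<and> psd_kernel n (\<lambda>i j. A $$ (i,j))"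
proof (cases "A \<in> carrier_mat n n")
  case True
  have "(\<forall>v \<in> carrier_vec n. R (conjugate v \<bullet> (A *\<^sub>v v)))
      \<longleftrightarrow> (\<forall>x. R (quad n (\<lambda>i j. A $$ (i,j)) x x))" for R
  proof -
    have "(\<forall>v \<in> carrier_vec n. R (conjugate v \<bullet> (A *\<^sub>v v)))
      \<longleftrightarrow> (\<forall>x. R (conjugate (vec n x) \<bullet> (A *\<^sub>v vec n x)))"
    proof (intro iffI ballI allI)
      fix v :: "complex vec" assume *: "\<forall>x. R (conjugate (vec n x) \<bullet> (A *\<^sub>v vec n x))" "v \<in> carrier_vec n"
      then have "v = vec n (\<lambda>i. v $ i)" by auto
      then show "R (conjugate v \<bullet> (A *\<^sub>v v))" using * by metis
    qed auto
    then show ?thesis by (simp add: scalar_prod_mult_mat_vec_quad[OF True])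
  qed
  then show ?thesis using True by (simp add: psd_def psd_kernel_def)
qed (simp add: psd_def)

lemma psd_mat_iff: "psd n (mat n n (\<lambda>(i,j). a i j)) \<longleftrightarrow> psd_kernel n a"
  unfolding psd_iff by (simp cong: psd_kernel_cong)

section \<open>Bipartite operators and separability\<close>

lemma sum_lessThan_mult:
  fixes a b :: nat
  shows "(\<Sum>r<a*b. f (r div b) (r mod b)) = (\<Sum>i<a. \<Sum>k<b. f i k)"
proof -
  have "(\<Sum>r<a*b. f (r div b) (r mod b)) = (\<Sum>i<a. \<Sum>r=i*b..<i*b+b. f (r div b) (r mod b))"
    by (rule sum.nat_group[symmetric])
  also have "\<dots> = (\<Sum>i<a. \<Sum>k<b. f i k)"
  proof (rule sum.cong[OF refl])
    fix i
    have "(\<Sum>r=i*b..<i*b+b. f (r div b) (r mod b)) = (\<Sum>k<b. f ((k + i*b) div b) ((k + i*b) mod b))"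
      using sum.shift_bounds_nat_ivl[of "\<lambda>r. f (r div b) (r mod b)" 0 "i*b" b]
      by (simp add: add.commute atLeast0LessThan)
    then show "(\<Sum>r=i*b..<i*b+b. f (r div b) (r mod b)) = (\<Sum>k<b. f i k)" by simp
  qed
  finally show ?thesis .
qed

lemma mult_add_less:
  fixes a b :: nat
  assumes "i < a" "k < b"
  shows "i * b + k < a * b"
proof -
  have "i * b + k < Suc i * b" using assms(2) by simp
  also have "\<dots> \<le> a * b" using assms(1) by (intro mult_le_mono1) simp
  finally show ?thesis .
qed

lemma div_mod_less:
  fixes a b :: nat
  assumes "r < a * b"
  shows "r div b < a" "r mod b < b"
proof -
  have "b > 0" using assms by (cases b) auto
  then show "r div b < a" "r mod b < b"
    using assms by (simp_all add: less_mult_imp_div_less)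
qed

section \<open>Basis vectors and normalisation of positive kernels\<close>

definition unit_fun :: "nat \<Rightarrow> nat \<Rightarrow> complex" where
  "unit_fun i = (\<lambda>k. of_bool (k = i))"

lemma quad_unit_fun: "i < n \<Longrightarrow> j < n \<Longrightarrow> quad n a (unit_fun i) (unit_fun j) = a i j"
proof -
  assume ij: "i < n" "j < n"
  have "quad n a (unit_fun i) (unit_fun j) = (\<Sum>k<n. if k = i then (\<Sum>l<n. if l = j then a i j else 0) else 0)"
    unfolding quad_def unit_fun_def by (intro sum.cong refl) (auto intro!: sum.cong sum.neutral)
  then show ?thesis using ij by simp
qed

text \<open>The diagonal entries are nonnegative with sum 0, so every basis vector is null and
  therefore in the radical.\<close>

lemma psd_kernel_trace_zero:
  assumes "psd_kernel n a" "(\<Sum>i<n. Re (a i i)) = 0" "i < n" "j < n"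
  shows "a i j = 0"
proof -
  note f = psd_form_quad[OF assms(1)]
  have nn: "0 \<le> Re (a k k)" if "k < n" for k
    using psd_form_nonneg[OF f, of "unit_fun k"] that by (simp add: quad_unit_fun)
  then have "Re (a i i) = 0"
    using assms(2,3) by (subst (asm) sum_nonneg_eq_0_iff) auto
  moreover have "Im (a i i) = 0"
    using psd_form_real[OF f, of "unit_fun i"] assms(3) by (simp add: quad_unit_fun)
  ultimately have "quad n a (unit_fun i) (unit_fun i) = 0"
    using assms(3) by (simp add: quad_unit_fun complex_eq_iff)
  from psd_form_null_left[OF f this, of "unit_fun j"] show ?thesis
    using assms(3,4) by (simp add: quad_unit_fun)
qed

text \<open>Allows separability to be handled with unnormalised positive kernels; the trace becomes
  the weight.\<close>

lemma psd_kernel_normalise: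
  assumes a: "psd_kernel n a" and n: "n > 0"
  obtains t :: real and \<sigma> where "t \<ge> 0" "density n \<sigma>"
    "\<And>i j. i < n \<Longrightarrow> j < n \<Longrightarrow> a i j = of_real t * \<sigma> $$ (i,j)"
proof -
  define t where "t = (\<Sum>i<n. Re (a i i))"
  note f = psd_form_quad[OF a]
  have re: "a k k = of_real (Re (a k k))" if "k < n" for k
    using psd_form_eq_Re[OF f, of "unit_fun k"] that by (simp add: quad_unit_fun)
  have nn: "0 \<le> Re (a k k)" if "k < n" for k
    using psd_form_nonneg[OF f, of "unit_fun k"] that by (simp add: quad_unit_fun)
  have t: "t \<ge> 0" unfolding t_def by (intro sum_nonneg) (simp add: nn)
  show ?thesis
  proof (cases "t = 0")
    case True
    \<comment> \<open>The kernel vanishes, so any density with weight 0 will do;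
      \<open>n > 0\<close> provides the projector onto the first basis vector.\<close>
    define \<sigma> where "\<sigma> = mat n n (\<lambda>(i,j). unit_fun 0 i * cnj (unit_fun 0 j))"
    have "mtrace \<sigma> = (\<Sum>i<n. if i = 0 then 1 else 0)"
      unfolding mtrace_def \<sigma>_def by (intro sum.cong) (auto simp: unit_fun_def)
    then have "density n \<sigma>"
      using n psd_kernel_outer[of n "unit_fun 0"] by (simp add: density_def \<sigma>_def psd_mat_iff)
    moreover have "a i j = 0" if "i < n" "j < n" for i j
      using psd_kernel_trace_zero[OF a True[unfolded t_def] that] .
    ultimately show ?thesis by (intro that[of 0 \<sigma>]) simp_all
  next
    case False
    define \<sigma> where "\<sigma> = mat n n (\<lambda>(i,j). of_real (1 / t) * a i j)"
    have "mtrace \<sigma> = (\<Sum>i<n. of_real (1 / t) * of_real (Re (a i i)))"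
      unfolding mtrace_def \<sigma>_def by (simp add: re[symmetric])
    also have "\<dots> = of_real (1 / t * t)"
      unfolding t_def of_real_mult of_real_sum sum_distrib_left ..
    finally have "mtrace \<sigma> = 1" using False by simp
    moreover have "psd n \<sigma>"
      unfolding \<sigma>_def psd_mat_iff using t by (intro psd_kernel_scale a) simp
    ultimately show ?thesis
      using t False by (intro that[of t \<sigma>]) (auto simp: density_def \<sigma>_def)
  qed
qed

text \<open>\<open>R i k j l\<close> is the entry in row \<open>e\<^sub>i \<otimes> f\<^sub>k\<close> and column \<open>e\<^sub>j \<otimes> f\<^sub>l\<close>.\<close>
definition bip :: "nat \<Rightarrow> nat \<Rightarrow> (nat \<Rightarrow> nat \<Rightarrow> nat \<Rightarrow> nat \<Rightarrow> complex) \<Rightarrow> complex mat" where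
  "bip dA dB R = mat (dA*dB) (dA*dB) (\<lambda>(r,c). R (r div dB) (r mod dB) (c div dB) (c mod dB))"

lemma bip_index:
  assumes "i < dA" "j < dA" "k < dB" "l < dB"
  shows "bip dA dB R $$ (i * dB + k, j * dB + l) = R i k j l"
  using assms by (simp add: bip_def mult_add_less)

lemma bip_cong:
  assumes "\<And>i j k l. i < dA \<Longrightarrow> j < dA \<Longrightarrow> k < dB \<Longrightarrow> l < dB \<Longrightarrow> R i k j l = S i k j l"
  shows "bip dA dB R = bip dA dB S"
  unfolding bip_def by (rule eq_matI) (auto simp: assms div_mod_less)

lemma bip_eqD:
  assumes "bip dA dB R = bip dA dB S" "i < dA" "j < dA" "k < dB" "l < dB"
  shows "R i k j l = S i k j l"
  using bip_index[OF assms(2-5)] assms(1) by metis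

lemma bip_of_mat:
  assumes "\<rho> \<in> carrier_mat (dA*dB) (dA*dB)"
  shows "\<rho> = bip dA dB (\<lambda>i k j l. \<rho> $$ (i * dB + k, j * dB + l))"
  using assms by (intro eq_matI) (auto simp: bip_def)

lemma mtrace_bip: "mtrace (bip dA dB R) = (\<Sum>i<dA. \<Sum>k<dB. R i k i k)"
  unfolding mtrace_def bip_def
  using sum_lessThan_mult[of "\<lambda>i k. R i k i k"] by simp

lemma kron_sum_bip:
  assumes "\<And>n. n < N \<Longrightarrow> \<sigma> n \<in> carrier_mat dA dA" "\<And>n. n < N \<Longrightarrow> \<tau> n \<in> carrier_mat dB dB"
  shows "mat (dA*dB) (dA*dB) (\<lambda>(r,c). \<Sum>n<N. q n * kron (\<sigma> n) (\<tau> n) $$ (r,c))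
    = bip dA dB (\<lambda>i k j l. \<Sum>n<N. q n * (\<sigma> n $$ (i,j) * \<tau> n $$ (k,l)))"
  unfolding bip_def
proof (rule cong_mat)
  fix r c assume rc: "r < dA*dB" "c < dA*dB"
  have "kron (\<sigma> n) (\<tau> n) $$ (r,c) = \<sigma> n $$ (r div dB, c div dB) * \<tau> n $$ (r mod dB, c mod dB)"
    if "n < N" for n
    using rc carrier_matD[OF assms(1)[OF that]] carrier_matD[OF assms(2)[OF that]]
    by (simp add: kron_def)
  then show "(case (r,c) of (r,c) \<Rightarrow> \<Sum>n<N. q n * kron (\<sigma> n) (\<tau> n) $$ (r,c)) =
      (case (r,c) of (r,c) \<Rightarrow> \<Sum>n<N. q n * (\<sigma> n $$ (r div dB, c div dB) * \<tau> n $$ (r mod dB, c mod dB)))"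
    by simp
qed auto

text \<open>The probabilities are absorbed into the first factors, which removes all normalisation
  conditions.\<close>

lemma separable_bipD:
  assumes "separable dA dB (bip dA dB R)"
  shows "\<exists>(N::nat) a b. (\<forall>n<N. psd_kernel dA (a n) \<and> psd_kernel dB (b n)) \<and>
    (\<forall>i<dA. \<forall>j<dA. \<forall>k<dB. \<forall>l<dB. R i k j l = (\<Sum>n<N. a n i j * b n k l))"
proof -
  obtain N :: nat and p :: "nat \<Rightarrow> real" and \<sigma> \<tau> where
    *: "\<And>n. n < N \<Longrightarrow> p n \<ge> 0 \<and> density dA (\<sigma> n) \<and> density dB (\<tau> n)" and
    eq: "bip dA dB R = mat (dA*dB) (dA*dB) (\<lambda>(r,c). \<Sum>n<N. of_real (p n) * kron (\<sigma> n) (\<tau> n) $$ (r,c))"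
    using assms unfolding separable_def by blast
  have psd: "psd dA (\<sigma> n)" "psd dB (\<tau> n)" if "n < N" for n
    using *[OF that] by (auto simp: density_def)
  have eq': "bip dA dB R = bip dA dB (\<lambda>i k j l. \<Sum>n<N. of_real (p n) * (\<sigma> n $$ (i,j) * \<tau> n $$ (k,l)))"
    unfolding eq by (rule kron_sum_bip) (use psd psd_iff in blast)+
  have "psd_kernel dA (\<lambda>i j. of_real (p n) * \<sigma> n $$ (i,j))" "psd_kernel dB (\<lambda>k l. \<tau> n $$ (k,l))"
    if "n < N" for n
    using psd[OF that] *[OF that] psd_kernel_scale by (auto simp: psd_iff)
  moreover have "R i k j l = (\<Sum>n<N. of_real (p n) * \<sigma> n $$ (i,j) * \<tau> n $$ (k,l))"
    if "i < dA" "j < dA" "k < dB" "l < dB" for i j k l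
    using bip_eqD[OF eq' that] by (simp add: mult.assoc)
  ultimately show ?thesis
    by (intro exI[of _ N] exI[of _ "\<lambda>n i j. of_real (p n) * \<sigma> n $$ (i,j)"]
        exI[of _ "\<lambda>n k l. \<tau> n $$ (k,l)"]) simp
qed

text \<open>Normalising the factors turns their traces into weights \<open>s n * t n\<close>, and
  these sum to the trace of the whole operator, which is 1.\<close>

lemma separable_bipI:
  fixes N :: nat
  assumes a: "\<And>n. n < N \<Longrightarrow> psd_kernel dA (a n)" and b: "\<And>n. n < N \<Longrightarrow> psd_kernel dB (b n)"
    and R: "\<And>i j k l. i < dA \<Longrightarrow> j < dA \<Longrightarrow> k < dB \<Longrightarrow> l < dB \<Longrightarrow>
       R i k j l = (\<Sum>n<N. a n i j * b n k l)"
    and tr: "mtrace (bip dA dB R) = 1"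
  shows "separable dA dB (bip dA dB R)"
proof -
  have pos: "dA > 0" "dB > 0" using tr unfolding mtrace_bip by (auto intro!: Nat.gr0I)
  have "\<exists>t \<sigma>. t \<ge> 0 \<and> density dA \<sigma> \<and> (\<forall>i<dA. \<forall>j<dA. a n i j = of_real t * \<sigma> $$ (i,j))" if "n < N" for n
    using psd_kernel_normalise[OF a[OF that] pos(1)] by metis
  then obtain s \<sigma> where \<sigma>: "\<And>n. n < N \<Longrightarrow> s n \<ge> 0 \<and> density dA (\<sigma> n) \<and>
      (\<forall>i<dA. \<forall>j<dA. a n i j = of_real (s n) * \<sigma> n $$ (i,j))" by metis
  have "\<exists>t \<tau>. t \<ge> 0 \<and> density dB \<tau> \<and> (\<forall>i<dB. \<forall>j<dB. b n i j = of_real t * \<tau> $$ (i,j))" if "n < N" for n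
    using psd_kernel_normalise[OF b[OF that] pos(2)] by metis
  then obtain t \<tau> where \<tau>: "\<And>n. n < N \<Longrightarrow> t n \<ge> 0 \<and> density dB (\<tau> n) \<and>
      (\<forall>i<dB. \<forall>j<dB. b n i j = of_real (t n) * \<tau> n $$ (i,j))" by metis
  have carr: "\<sigma> n \<in> carrier_mat dA dA" "\<tau> n \<in> carrier_mat dB dB" if "n < N" for n
    using \<sigma>[OF that] \<tau>[OF that] by (auto simp: density_def psd_iff)
  have R': "R i k j l = (\<Sum>n<N. of_real (s n * t n) * (\<sigma> n $$ (i,j) * \<tau> n $$ (k,l)))"
    if "i < dA" "j < dA" "k < dB" "l < dB" for i j k l
    unfolding R[OF that] using \<sigma> \<tau> that by (intro sum.cong refl) simp
  have eq: "bip dA dB R = mat (dA*dB) (dA*dB) (\<lambda>(r,c). \<Sum>n<N. of_real (s n * t n) * kron (\<sigma> n) (\<tau> n) $$ (r,c))"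
    by (subst kron_sum_bip) (use carr R' in \<open>auto intro!: bip_cong\<close>)
  have "(1::complex) = (\<Sum>i<dA. \<Sum>k<dB. R i k i k)" using tr unfolding mtrace_bip by simp
  also have "\<dots> = (\<Sum>i<dA. \<Sum>k<dB. \<Sum>n<N. of_real (s n * t n) * (\<sigma> n $$ (i,i) * \<tau> n $$ (k,k)))"
    using R' by simp
  also have "\<dots> = (\<Sum>i<dA. \<Sum>n<N. \<Sum>k<dB. of_real (s n * t n) * (\<sigma> n $$ (i,i) * \<tau> n $$ (k,k)))"
    by (intro sum.cong refl sum.swap)
  also have "\<dots> = (\<Sum>n<N. \<Sum>i<dA. \<Sum>k<dB. of_real (s n * t n) * (\<sigma> n $$ (i,i) * \<tau> n $$ (k,k)))"
    by (rule sum.swap)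
  also have "\<dots> = (\<Sum>n<N. of_real (s n * t n) * ((\<Sum>i<dA. \<sigma> n $$ (i,i)) * (\<Sum>k<dB. \<tau> n $$ (k,k))))"
    unfolding sum_product by (simp only: sum_distrib_left)
  also have "\<dots> = (\<Sum>n<N. of_real (s n * t n))"
  proof (intro sum.cong refl)
    fix n assume n: "n \<in> {..<N}"
    then have "(\<Sum>i<dA. \<sigma> n $$ (i,i)) = 1" "(\<Sum>k<dB. \<tau> n $$ (k,k)) = 1"
      using \<sigma>[of n] \<tau>[of n] carr[of n] by (auto simp: density_def mtrace_def)
    then show "of_real (s n * t n) * ((\<Sum>i<dA. \<sigma> n $$ (i,i)) * (\<Sum>k<dB. \<tau> n $$ (k,k)))
        = complex_of_real (s n * t n)" by simp
  qed
  finally have "(\<Sum>n<N. s n * t n) = 1"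
    by (metis of_real_eq_1_iff of_real_sum)
  then show ?thesis unfolding separable_def
    using \<sigma> \<tau> eq by (intro exI[of _ N] exI[of _ "\<lambda>n. s n * t n"] exI[of _ \<sigma>] exI[of _ \<tau>]) auto
qed

text \<open>For a product operator \<open>\<sigma> \<otimes> \<tau>\<close>, positivity and \<open>\<langle>u f\<^sub>k| \<sigma> \<otimes> \<tau> |u f\<^sub>k\<rangle> = 0\<close> force
  \<open>\<sigma> u = 0\<close> or \<open>\<tau> f\<^sub>k = 0\<close>; either kills the off-diagonal entry below.\<close>
lemma not_separable_bip:
  assumes null: "quad dA (\<lambda>i j. R i k j k) u u = 0"
    and nonnull: "quad dA (\<lambda>i j. R i k j l) p u \<noteq> 0"
    and k: "k < dB" "l < dB"
  shows "\<not> separable dA dB (bip dA dB R)"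
proof
  assume "separable dA dB (bip dA dB R)"
  from separable_bipD[OF this] obtain N :: nat and a b where
    a: "\<And>n. n < N \<Longrightarrow> psd_kernel dA (a n)" and b: "\<And>n. n < N \<Longrightarrow> psd_kernel dB (b n)" and
    R: "\<And>i j k l. i < dA \<Longrightarrow> j < dA \<Longrightarrow> k < dB \<Longrightarrow> l < dB \<Longrightarrow>
       R i k j l = (\<Sum>n<N. a n i j * b n k l)"
    by blast
  have quadR: "quad dA (\<lambda>i j. R i k j m) x y = (\<Sum>n<N. b n k m * quad dA (a n) x y)" if "m < dB" for m x y
  proof -
    have "quad dA (\<lambda>i j. R i k j m) x y = quad dA (\<lambda>i j. \<Sum>n<N. b n k m * a n i j) x y"
      by (rule quad_cong) (use R k that in \<open>auto simp: mult.commute\<close>)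
    then show ?thesis by (simp add: quad_sum quad_scale)
  qed
  have bkk: "b n k m = quad dB (b n) (unit_fun k) (unit_fun m)" if "m < dB" for n m
    using k that by (simp add: quad_unit_fun)
  have re: "b n k k * quad dA (a n) u u = of_real (Re (b n k k) * Re (quad dA (a n) u u))"
    and nn: "0 \<le> Re (b n k k) * Re (quad dA (a n) u u)" if "n < N" for n
    using psd_form_eq_Re[OF psd_form_quad[OF a[OF that]], of u]
      psd_form_eq_Re[OF psd_form_quad[OF b[OF that]], of "unit_fun k"]
      psd_form_nonneg[OF psd_form_quad[OF a[OF that]], of u]
      psd_form_nonneg[OF psd_form_quad[OF b[OF that]], of "unit_fun k"]
    unfolding bkk[OF k(1), symmetric] by (metis of_real_mult, simp)
  \<comment> \<open>The vanishing diagonal value is a sum of nonnegative products, so each product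
    vanishes separately.\<close>
  have "(\<Sum>n<N. Re (b n k k) * Re (quad dA (a n) u u)) = 0"
    using null unfolding quadR[OF k(1)] using re by (simp flip: of_real_sum of_real_mult)
  then have z: "Re (b n k k) * Re (quad dA (a n) u u) = 0" if "n < N" for n
    using nn that by (subst (asm) sum_nonneg_eq_0_iff) auto
  have "b n k l * quad dA (a n) p u = 0" if "n < N" for n
  proof -
    have "b n k k = 0 \<or> quad dA (a n) u u = 0" using z[OF that] re[OF that] by auto
    then show ?thesis
    proof
      assume "b n k k = 0"
      then have "b n k l = 0"
        using psd_form_null_left[OF psd_form_quad[OF b[OF that]], of "unit_fun k" "unit_fun l"] bkk k by simp
      then show ?thesis by simp
    next
      assume "quad dA (a n) u u = 0"
      then show ?thesis using psd_form_null_right[OF psd_form_quad[OF a[OF that]], of u p] by simp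
    qed
  qed
  then have "quad dA (\<lambda>i j. R i k j l) p u = 0"
    unfolding quadR[OF k(2)] by (intro sum.neutral) simp
  with nonnull show False by simp
qed

section \<open>Choi form of a channel\<close>

lemma linear_map_on_sum:
  assumes lin: "linear_map_on d \<phi>" and fin: "finite I"
  shows "\<phi> (mat d d (\<lambda>(i,j). \<Sum>m\<in>I. c m * g m i j))
    = mat d d (\<lambda>(i,j). \<Sum>m\<in>I. c m * \<phi> (mat d d (\<lambda>(i,j). g m i j)) $$ (i,j))"
  using fin
proof (induction I rule: finite_induct)
  case empty
  \<comment> \<open>The empty sum requires that \<open>\<phi>\<close> maps zero to zero; this is
    homogeneity with scalar 0.\<close>
  let ?Z = "mat d d (\<lambda>(i,j). 0 :: complex)"
  have Z: "?Z = 0 \<cdot>\<^sub>m ?Z" by (rule eq_matI) auto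
  have carr: "\<phi> ?Z \<in> carrier_mat d d"
    using lin by (simp add: linear_map_on_def)
  have "\<phi> (0 \<cdot>\<^sub>m ?Z) = 0 \<cdot>\<^sub>m \<phi> ?Z"
    using lin by (simp add: linear_map_on_def)
  then have eq: "\<phi> ?Z = 0 \<cdot>\<^sub>m \<phi> ?Z"
    using Z by simp
  have "\<phi> ?Z $$ (i,j) = 0" if "i < d" "j < d" for i j
  proof -
    have "\<phi> ?Z $$ (i,j) = (0 \<cdot>\<^sub>m \<phi> ?Z) $$ (i,j)" by (rule arg_cong[OF eq])
    then show ?thesis using carr that by simp
  qed
  then have "\<phi> ?Z = ?Z" using carr by (intro eq_matI) auto
  then show ?case by (simp only: sum.empty)
next
  case (insert m I)
  let ?G = "\<lambda>m. mat d d (\<lambda>(i,j). g m i j)"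
  let ?S = "mat d d (\<lambda>(i,j). \<Sum>m\<in>I. c m * g m i j)"
  have carr: "\<phi> (?G m) \<in> carrier_mat d d"
    using lin unfolding linear_map_on_def by simp
  have "mat d d (\<lambda>(i,j). \<Sum>m\<in>insert m I. c m * g m i j) = c m \<cdot>\<^sub>m ?G m + ?S"
    using insert.hyps by (intro eq_matI) auto
  also have "\<phi> \<dots> = c m \<cdot>\<^sub>m \<phi> (?G m) + \<phi> ?S"
    using lin unfolding linear_map_on_def by simp
  also have "\<dots> = mat d d (\<lambda>(i,j). \<Sum>m\<in>insert m I. c m * \<phi> (?G m) $$ (i,j))"
    unfolding insert.IH using insert.hyps carr by (intro eq_matI) auto
  finally show ?case .
qed

text \<open>The entries of the Choi matrix: \<open>p\<close>, \<open>q\<close> select a matrix unit,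
  \<open>i\<close>, \<open>j\<close> an entry of its image.\<close>

definition map_entry :: "nat \<Rightarrow> (complex mat \<Rightarrow> complex mat) \<Rightarrow> nat \<Rightarrow> nat \<Rightarrow> nat \<Rightarrow> nat \<Rightarrow> complex" where
  "map_entry d \<phi> p q i j = \<phi> (mat d d (\<lambda>(a,b). of_bool (a = p \<and> b = q))) $$ (i,j)"

text \<open>The action on entry functions, linear in \<open>x\<close> by construction; for linear
  \<open>\<phi>\<close> it agrees with \<open>\<phi>\<close> by
  \<open>linear_map_on_mat\<close>.\<close>

definition map_kernel :: "nat \<Rightarrow> (complex mat \<Rightarrow> complex mat) \<Rightarrow> (nat \<Rightarrow> nat \<Rightarrow> complex) \<Rightarrow> nat \<Rightarrow> nat \<Rightarrow> complex" where
  "map_kernel d \<phi> x i j = (\<Sum>p<d. \<Sum>q<d. x p q * map_entry d \<phi> p q i j)"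

lemma linear_map_on_mat:
  assumes lin: "linear_map_on d \<phi>"
  shows "\<phi> (mat d d (\<lambda>(i,j). x i j)) = mat d d (\<lambda>(i,j). map_kernel d \<phi> x i j)"
proof -
  have "mat d d (\<lambda>(i,j). x i j) = mat d d (\<lambda>(i,j).
      \<Sum>m\<in>{..<d}\<times>{..<d}. x (fst m) (snd m) * of_bool (i = fst m \<and> j = snd m))"
  proof (rule cong_mat)
    fix i j assume "i < d" "j < d"
    then have "(\<Sum>m\<in>{..<d}\<times>{..<d}. x (fst m) (snd m) * of_bool (i = fst m \<and> j = snd m))
      = (\<Sum>m\<in>{(i,j)}. x (fst m) (snd m) * of_bool (i = fst m \<and> j = snd m))"
      by (intro sum.mono_neutral_right) auto
    then show "(case (i,j) of (i,j) \<Rightarrow> x i j) = (case (i,j) of (i,j) \<Rightarrow>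
      \<Sum>m\<in>{..<d}\<times>{..<d}. x (fst m) (snd m) * of_bool (i = fst m \<and> j = snd m))" by simp
  qed auto
  also have "\<phi> \<dots> = mat d d (\<lambda>(i,j). map_kernel d \<phi> x i j)"
    by (subst linear_map_on_sum[OF lin])
      (simp_all add: map_kernel_def[abs_def] map_entry_def sum.cartesian_product case_prod_beta)
  finally show ?thesis .
qed

lemma map_kernel_add: "map_kernel d \<phi> (\<lambda>p q. x p q + y p q) i j = map_kernel d \<phi> x i j + map_kernel d \<phi> y i j"
  and map_kernel_scale: "map_kernel d \<phi> (\<lambda>p q. c * x p q) i j = c * map_kernel d \<phi> x i j"
  by (simp_all add: map_kernel_def sum.distrib sum_distrib_left algebra_simps)

lemma map_kernel_sum: "map_kernel d \<phi> (\<lambda>p q. \<Sum>m\<in>I. x m p q) i j = (\<Sum>m\<in>I. map_kernel d \<phi> (x m) i j)"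
proof -
  have "(\<Sum>m\<in>I. map_kernel d \<phi> (x m) i j)
      = (\<Sum>p<d. \<Sum>m\<in>I. \<Sum>q<d. x m p q * map_entry d \<phi> p q i j)"
    unfolding map_kernel_def by (rule sum.swap)
  also have "\<dots> = (\<Sum>p<d. \<Sum>q<d. \<Sum>m\<in>I. x m p q * map_entry d \<phi> p q i j)"
    by (intro sum.cong refl sum.swap)
  finally show ?thesis by (simp add: map_kernel_def sum_distrib_right)
qed

lemma map_kernel_cong:
  assumes "\<And>p q. p < d \<Longrightarrow> q < d \<Longrightarrow> x p q = y p q"
  shows "map_kernel d \<phi> x i j = map_kernel d \<phi> y i j"
  unfolding map_kernel_def using assms by simp

lemma map_kernel_unit_fun:
  assumes "a < d" "b < d"
  shows "map_kernel d \<phi> (\<lambda>p q. unit_fun a p * cnj (unit_fun b q)) i j = map_entry d \<phi> a b i j"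
proof -
  have "map_kernel d \<phi> (\<lambda>p q. unit_fun a p * cnj (unit_fun b q)) i j
      = (\<Sum>p<d. \<Sum>q<d. if q = b then if p = a then map_entry d \<phi> a b i j else 0 else 0)"
    unfolding map_kernel_def by (intro sum.cong refl) (auto simp: unit_fun_def)
  then show ?thesis using assms by simp
qed

lemma map_kernel_index:
  assumes "linear_map_on d \<phi>" "i < d" "j < d"
  shows "map_kernel d \<phi> x i j = \<phi> (mat d d (\<lambda>(i,j). x i j)) $$ (i,j)"
  using assms(2,3) by (simp add: linear_map_on_mat[OF assms(1)])

lemma map_kernel_trace:
  assumes lin: "linear_map_on d \<phi>" and tp: "trace_preserving d \<phi>"
  shows "(\<Sum>i<d. map_kernel d \<phi> x i i) = (\<Sum>i<d. x i i)"
proof -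
  let ?X = "mat d d (\<lambda>(i,j). x i j)"
  have "\<phi> ?X \<in> carrier_mat d d" using lin by (simp add: linear_map_on_def)
  then have "(\<Sum>i<d. map_kernel d \<phi> x i i) = mtrace (\<phi> ?X)"
    using map_kernel_index[OF lin] by (simp add: mtrace_def)
  also have "\<dots> = mtrace ?X" using tp by (simp add: trace_preserving_def)
  finally show ?thesis by (simp add: mtrace_def)
qed

lemma ext_id_bip:
  assumes lin: "linear_map_on d \<phi>"
  shows "ext_id \<phi> d dB (bip d dB R) = bip d dB (\<lambda>i k j l. map_kernel d \<phi> (\<lambda>p q. R p k q l) i j)"
  unfolding ext_id_def bip_def[of d dB "\<lambda>i k j l. map_kernel d \<phi> (\<lambda>p q. R p k q l) i j"]
proof (rule cong_mat)
  fix r c assume rc: "r < d * dB" "c < d * dB"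
  note b = div_mod_less[OF rc(1)] div_mod_less[OF rc(2)]
  have "mat d d (\<lambda>(i,j). bip d dB R $$ (i * dB + r mod dB, j * dB + c mod dB))
      = mat d d (\<lambda>(i,j). R i (r mod dB) j (c mod dB))"
    using b by (intro cong_mat) (auto simp: bip_index)
  then have "\<phi> (mat d d (\<lambda>(i,j). bip d dB R $$ (i * dB + r mod dB, j * dB + c mod dB))) $$ (r div dB, c div dB)
      = \<phi> (mat d d (\<lambda>(i,j). R i (r mod dB) j (c mod dB))) $$ (r div dB, c div dB)"
    by (simp only:)
  also have "\<dots> = map_kernel d \<phi> (\<lambda>p q. R p (r mod dB) q (c mod dB)) (r div dB) (c div dB)"
    using b by (simp add: linear_map_on_mat[OF lin])
  finally show "(case (r,c) of (r,c) \<Rightarrow> \<phi> (mat d d (\<lambda>(i,j). bip d dB R $$ (i * dB + r mod dB, j * dB + c mod dB)))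
        $$ (r div dB, c div dB)) =
      (case (r,c) of (r,c) \<Rightarrow> map_kernel d \<phi> (\<lambda>p q. R p (r mod dB) q (c mod dB)) (r div dB) (c div dB))"
    by (simp only: prod.case)
qed auto

text \<open>The index \<open>r\<close> follows the convention of \<open>bip\<close>:
  \<open>r div d\<close> belongs to the output of \<open>\<phi>\<close>, \<open>r mod d\<close> to
  the matrix unit.\<close>

definition choi :: "nat \<Rightarrow> (complex mat \<Rightarrow> complex mat) \<Rightarrow> (nat \<Rightarrow> complex) \<Rightarrow> (nat \<Rightarrow> complex) \<Rightarrow> complex" where
  "choi d \<phi> = quad (d*d) (\<lambda>r c. map_entry d \<phi> (r mod d) (c mod d) (r div d) (c div d))"

lemma psd_form_choi:
  assumes "quantum_channel d \<phi>"
  shows "psd_form (choi d \<phi>)"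
proof -
  have lin: "linear_map_on d \<phi>" and cp: "completely_positive d \<phi>"
    using assms by (auto simp: quantum_channel_def)
  \<comment> \<open>The unnormalised maximally entangled operator: its blocks are the matrix units,
    so \<open>\<phi> \<otimes> I\<close> sends it to the Choi matrix.\<close>
  let ?R = "\<lambda>i k j l. unit_fun k i * cnj (unit_fun l j)"
  have "psd (d*d) (bip d d ?R)"
    unfolding bip_def psd_mat_iff by (rule psd_kernel_outer)
  then have "psd (d*d) (ext_id \<phi> d d (bip d d ?R))"
    using cp by (simp add: completely_positive_def)
  then have "psd_kernel (d*d) (\<lambda>r c. map_kernel d \<phi> (\<lambda>p q. ?R p (r mod d) q (c mod d)) (r div d) (c div d))"
    unfolding ext_id_bip[OF lin] unfolding bip_def psd_mat_iff .
  then have "psd_kernel (d*d) (\<lambda>r c. map_entry d \<phi> (r mod d) (c mod d) (r div d) (c div d))"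
    by (simp add: map_kernel_unit_fun div_mod_less cong: psd_kernel_cong)
  then show ?thesis unfolding choi_def by (rule psd_form_quad)
qed

text \<open>The second factor is conjugated so that \<open>x\<close> enters \<open>choi_tens\<close>
  unconjugated, as the ket of a rank-one operator.\<close>

definition tens :: "nat \<Rightarrow> (nat \<Rightarrow> complex) \<Rightarrow> (nat \<Rightarrow> complex) \<Rightarrow> nat \<Rightarrow> complex" where
  "tens d v x = (\<lambda>r. v (r div d) * cnj (x (r mod d)))"

lemma tens_add_left: "tens d (\<lambda>i. v i + w i) x = (\<lambda>r. tens d v x r + tens d w x r)"
  and tens_scale_left: "tens d (\<lambda>i. c * v i) x = (\<lambda>r. c * tens d v x r)"
  and tens_add_right: "tens d v (\<lambda>i. x i + y i) = (\<lambda>r. tens d v x r + tens d v y r)"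
  and tens_scale_right: "tens d v (\<lambda>i. c * x i) = (\<lambda>r. cnj c * tens d v x r)"
  by (auto simp: tens_def algebra_simps)

lemma tens_sum_left: "tens d (\<lambda>i. \<Sum>a\<in>I. c a * v a i) x = (\<lambda>r. \<Sum>a\<in>I. c a * tens d (v a) x r)"
  unfolding tens_def sum_distrib_right mult.assoc ..

lemma tens_sum_right: "tens d v (\<lambda>i. \<Sum>a\<in>I. c a * x a i) = (\<lambda>r. \<Sum>a\<in>I. cnj (c a) * tens d v (x a) r)"
  unfolding tens_def cnj_sum complex_cnj_mult sum_distrib_left by (simp only: mult.left_commute)

lemma choi_tens_sum:
  "choi d \<phi> (tens d v x) (tens d w y) =
    (\<Sum>i<d. \<Sum>p<d. \<Sum>j<d. \<Sum>q<d. cnj (v i) * x p * map_entry d \<phi> p q i j * (w j * cnj (y q)))"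
  unfolding choi_def quad_def tens_def
  by (subst sum_lessThan_mult[of "\<lambda>j q. cnj (v i * cnj (x p)) * map_entry d \<phi> p q i j * (w j * cnj (y q))" d d for i p],
      subst sum_lessThan_mult[of "\<lambda>i p. \<Sum>j<d. \<Sum>q<d. cnj (v i * cnj (x p)) * map_entry d \<phi> p q i j * (w j * cnj (y q))" d d])
     simp

lemma choi_tens_cong:
  assumes "\<And>i. i < d \<Longrightarrow> v i = v' i" "\<And>i. i < d \<Longrightarrow> x i = x' i"
    and "\<And>i. i < d \<Longrightarrow> w i = w' i" "\<And>i. i < d \<Longrightarrow> y i = y' i"
  shows "choi d \<phi> (tens d v x) (tens d w y) = choi d \<phi> (tens d v' x') (tens d w' y')"
  unfolding choi_tens_sum using assms by simp

text \<open>The value is <v, \<phi>(|x><y|) w>, so statements about \<open>\<phi>\<close> on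
  rank-one operators become statements about one positive form.\<close>

lemma choi_tens:
  "choi d \<phi> (tens d v x) (tens d w y) = quad d (map_kernel d \<phi> (\<lambda>p q. x p * cnj (y q))) v w"
proof -
  have "choi d \<phi> (tens d v x) (tens d w y) =
    (\<Sum>i<d. \<Sum>j<d. \<Sum>p<d. \<Sum>q<d. cnj (v i) * x p * map_entry d \<phi> p q i j * (w j * cnj (y q)))"
    unfolding choi_tens_sum by (intro sum.cong refl sum.swap)
  then show ?thesis
    by (simp add: quad_def map_kernel_def sum_distrib_left sum_distrib_right algebra_simps)
qed

section \<open>Unitary conjugations preserve entanglement\<close>

lemma adj_carrier: "A \<in> carrier_mat n m \<Longrightarrow> adj A \<in> carrier_mat m n"
  by (intro carrier_matI) (auto simp: adj_def)

lemma adj_index: "A \<in> carrier_mat n m \<Longrightarrow> i < m \<Longrightarrow> j < n \<Longrightarrow> adj A $$ (i,j) = cnj (A $$ (j,i))"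
  by (auto simp: adj_def)

lemma adj_adj: "adj (adj A) = A"
proof (rule eq_matI)
  fix i j assume "i < dim_row A" "j < dim_col A"
  then show "adj (adj A) $$ (i,j) = A $$ (i,j)"
    by (subst adj_index[of _ "dim_col A" "dim_row A"])
      (auto simp: adj_index[of A "dim_row A" "dim_col A"] intro!: adj_carrier)
qed (simp_all add: adj_def)

lemma conj_index:
  assumes A: "A \<in> carrier_mat d d" and X: "X \<in> carrier_mat d d" and ij: "i < d" "j < d"
  shows "(A * X * adj A) $$ (i,j) = (\<Sum>p<d. \<Sum>q<d. A $$ (i,p) * X $$ (p,q) * cnj (A $$ (j,q)))"
proof -
  note A' = adj_carrier[OF A]
  have "(A * X * adj A) $$ (i,j) = (\<Sum>q<d. (\<Sum>p<d. A $$ (i,p) * X $$ (p,q)) * cnj (A $$ (j,q)))"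
    using A X A' ij adj_index[OF A]
    by (auto simp: scalar_prod_def atLeast0LessThan simp del: assoc_mult_mat intro!: sum.cong)
  also have "\<dots> = (\<Sum>p<d. \<Sum>q<d. A $$ (i,p) * X $$ (p,q) * cnj (A $$ (j,q)))"
    unfolding sum_distrib_right by (rule sum.swap)
  finally show ?thesis .
qed

lemma linear_map_on_conj:
  assumes A: "A \<in> carrier_mat d d"
  shows "linear_map_on d (\<lambda>X. A * X * adj A)"
  unfolding linear_map_on_def
proof (intro conjI ballI allI)
  note A' = adj_carrier[OF A]
  fix X Y :: "complex mat" and a assume X: "X \<in> carrier_mat d d" and Y: "Y \<in> carrier_mat d d"
  show "A * X * adj A \<in> carrier_mat d d" using A A' X by simp
  show "A * (X + Y) * adj A = A * X * adj A + A * Y * adj A"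
    using A A' X Y by (simp add: mult_add_distrib_mat[where n=d and nc=d] add_mult_distrib_mat[where nr=d and n=d])
  show "A * (a \<cdot>\<^sub>m X) * adj A = a \<cdot>\<^sub>m (A * X * adj A)"
    using A A' X by (simp add: mult_smult_distrib[where nr=d and n=d and nc=d] mult_smult_assoc_mat[where nr=d and n=d and nc=d])
qed

lemma psd_kernel_conj:
  assumes A: "A \<in> carrier_mat d d" and a: "psd_kernel d a"
  shows "psd_kernel d (map_kernel d (\<lambda>X. A * X * adj A) a)"
proof -
  let ?K = "\<lambda>i j. \<Sum>p<d. \<Sum>q<d. a p q * (A $$ (i,p) * cnj (A $$ (j,q)))"
  have "map_kernel d (\<lambda>X. A * X * adj A) a i j = ?K i j" if "i < d" "j < d" for i j
    unfolding map_kernel_index[OF linear_map_on_conj[OF A] that]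
    using that by (subst conj_index[OF A]) (simp_all add: mult_ac)
  \<comment> \<open>The conjugated form at \<open>x\<close> is the original form at
    \<open>adj A\<close> applied to \<open>x\<close>.\<close>
  moreover have "quad d ?K x x = quad d a (\<lambda>p. cnj (\<Sum>i<d. cnj (x i) * A $$ (i,p))) (\<lambda>p. cnj (\<Sum>i<d. cnj (x i) * A $$ (i,p)))" for x
    unfolding quad_sum quad_scale quad_outer unfolding quad_def by (simp add: mult_ac)
  ultimately show ?thesis
    using a by (simp add: psd_kernel_def cong: psd_kernel_cong)
qed

text \<open>Conjugation by \<open>adj U\<close> is a left inverse of \<open>\<phi>\<close> and keeps
  kernels positive. Applied to the first factors of a separable image it would decompose the
  original state.\<close>

lemma unitary_conj_UEP:
  assumes ch: "quantum_channel d \<phi>" and U: "unitary d U"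
    and \<phi>: "\<And>X. X \<in> carrier_mat d d \<Longrightarrow> \<phi> X = U * X * adj U"
  shows "UEP d \<phi>"
  unfolding UEP_def
proof (intro allI impI)
  fix dB \<rho> assume ent: "entangled d dB \<rho>"
  have lin: "linear_map_on d \<phi>" and cp: "completely_positive d \<phi>" and tp: "trace_preserving d \<phi>"
    using ch by (auto simp: quantum_channel_def)
  have Uc: "U \<in> carrier_mat d d" using U by (simp add: unitary_def)
  have Ac: "adj U \<in> carrier_mat d d" by (rule adj_carrier[OF Uc])
  have UU: "adj U * U = 1\<^sub>m d" using U by (simp add: unitary_def)
  let ?\<psi> = "\<lambda>X. adj U * X * adj (adj U)"
  have lin\<psi>: "linear_map_on d ?\<psi>" by (rule linear_map_on_conj[OF Ac])
  have inv: "?\<psi> (\<phi> X) = X" if X: "X \<in> carrier_mat d d" for X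
  proof -
    have "?\<psi> (\<phi> X) = (adj U * U) * X * (adj U * U)"
      unfolding \<phi>[OF X] adj_adj using Uc Ac X
      by (simp add: assoc_mult_mat[where n\<^sub>1=d and n\<^sub>2=d and n\<^sub>3=d and n\<^sub>4=d])
    then show ?thesis using X by (simp add: UU)
  qed
  have \<rho>: "density (d*dB) \<rho>" and nsep: "\<not> separable d dB \<rho>" using ent by (auto simp: entangled_def)
  have "\<rho> \<in> carrier_mat (d*dB) (d*dB)" using \<rho> by (simp add: density_def psd_iff)
  from bip_of_mat[OF this] obtain R where R: "\<rho> = bip d dB R" by blast
  define R' where "R' = (\<lambda>i k j l. map_kernel d \<phi> (\<lambda>p q. R p k q l) i j)"
  have img: "ext_id \<phi> d dB \<rho> = bip d dB R'"
    unfolding R R'_def by (rule ext_id_bip[OF lin])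
  \<comment> \<open>Summing over \<open>k\<close> outermost exposes the diagonal blocks, whose
    traces \<open>\<phi>\<close> preserves.\<close>
  have "mtrace (bip d dB R') = (\<Sum>k<dB. \<Sum>i<d. R' i k i k)"
    unfolding mtrace_bip by (rule sum.swap)
  also have "\<dots> = (\<Sum>k<dB. \<Sum>i<d. R i k i k)"
    unfolding R'_def by (intro sum.cong refl map_kernel_trace lin tp)
  also have "\<dots> = mtrace \<rho>" unfolding R mtrace_bip by (rule sum.swap)
  finally have dens: "density (d*dB) (ext_id \<phi> d dB \<rho>)"
    using cp \<rho> by (simp add: density_def img[symmetric] completely_positive_def)
  have "\<not> separable d dB (bip d dB R')"
  proof
    assume "separable d dB (bip d dB R')"
    from separable_bipD[OF this] obtain N :: nat and a b where
      a: "\<And>n. n < N \<Longrightarrow> psd_kernel d (a n)" and b: "\<And>n. n < N \<Longrightarrow> psd_kernel dB (b n)" and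
      R': "\<And>i j k l. i < d \<Longrightarrow> j < d \<Longrightarrow> k < dB \<Longrightarrow> l < dB \<Longrightarrow>
        R' i k j l = (\<Sum>n<N. a n i j * b n k l)" by blast
    have "R i k j l = (\<Sum>n<N. map_kernel d ?\<psi> (a n) i j * b n k l)"
      if ijkl: "i < d" "j < d" "k < dB" "l < dB" for i j k l
    proof -
      let ?X = "mat d d (\<lambda>(i,j). R i k j l)"
      have "R i k j l = ?\<psi> (\<phi> ?X) $$ (i,j)" using ijkl by (simp add: inv)
      also have "\<phi> ?X = mat d d (\<lambda>(i,j). R' i k j l)"
        unfolding R'_def by (rule linear_map_on_mat[OF lin])
      also have "?\<psi> \<dots> $$ (i,j) = map_kernel d ?\<psi> (\<lambda>i j. R' i k j l) i j"
        by (rule map_kernel_index[OF lin\<psi> ijkl(1,2), symmetric])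
      also have "\<dots> = map_kernel d ?\<psi> (\<lambda>i j. \<Sum>n<N. b n k l * a n i j) i j"
        by (rule map_kernel_cong) (simp add: R' ijkl mult.commute)
      finally show ?thesis unfolding map_kernel_sum map_kernel_scale by (simp add: mult.commute)
    qed
    then have "separable d dB (bip d dB R)"
      using \<rho> R by (intro separable_bipI[OF psd_kernel_conj[OF Ac a] b]) (auto simp: density_def)
    with nsep R show False by simp
  qed
  then show "entangled d dB (ext_id \<phi> d dB \<rho>)" using dens by (simp add: entangled_def img)
qed

section \<open>Entanglement preservation forces a single Kraus operator\<close>

text \<open>If the conclusion failed, \<open>\<phi>(u u\<^sup>*)\<close> would be dominated by a multiple \<open>c\<close> of \<open>\<phi>(P)\<close>, where
  \<open>P = \<Sum> w\<^sub>m w\<^sub>m\<^sup>*\<close> annihilates \<open>u\<close>. The operator with blocks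
  \<open>(P, \<epsilon> p u\<^sup>*; \<epsilon> u p\<^sup>*, P + \<epsilon>\<^sup>2 u u\<^sup>*)\<close>, \<open>p = w\<^sub>m\<^sub>0\<close>, is entangled for every \<open>\<epsilon> > 0\<close>, while for
  \<open>\<epsilon> = 1/(1+c)\<close> its image under \<open>\<phi> \<otimes> I\<close> is
  \<open>1/4 \<Sum>\<^bsub>\<alpha>\<^sup>4=1\<^esub> \<phi>(P + \<epsilon> (cnj \<alpha> p u\<^sup>* + \<alpha> u p\<^sup>*)) \<otimes> (1, \<alpha>; cnj \<alpha>, 1) + \<epsilon>\<^sup>2 \<phi>(u u\<^sup>*) \<otimes> (0, 0; 0, 1)\<close>
  with positive summands.\<close>
lemma UEP_separating_vector:
  fixes M :: nat
  assumes ch: "quantum_channel d \<phi>" and uep: "UEP d \<phi>"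
    and orth: "\<And>m. m < M \<Longrightarrow> (\<Sum>i<d. cnj (u i) * w m i) = 0"
    and m0: "m0 < M" and p0: "(\<Sum>i<d. cnj (w m0 i) * w m0 i) \<noteq> 0"
    and u0: "(\<Sum>i<d. cnj (u i) * u i) \<noteq> 0"
  shows "\<exists>v. (\<forall>m<M. choi d \<phi> (tens d v (w m)) (tens d v (w m)) = 0) \<and>
    choi d \<phi> (tens d v u) (tens d v u) \<noteq> 0"
proof (rule ccontr)
  assume neg: "\<not> ?thesis"
  have lin: "linear_map_on d \<phi>" using ch by (simp add: quantum_channel_def)
  note choi = psd_form_choi[OF ch]
  let ?S = "\<lambda>x y v. choi d \<phi> (tens d v x) (tens d v y)"
  define A where "A = (\<lambda>v v'. \<Sum>m<M. choi d \<phi> (tens d v (w m)) (tens d v' (w m)))"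
  define C where "C = (\<lambda>v v'. choi d \<phi> (tens d v u) (tens d v' u))"
  have form: "psd_form (\<lambda>v v'. choi d \<phi> (tens d v x) (tens d v' x))" for x
    by (rule psd_form_comp[OF choi]) (simp_all add: tens_add_left tens_scale_left)
  have Aform: "psd_form A" unfolding A_def by (rule psd_form_sum) (rule form)
  have Cform: "psd_form C" unfolding C_def by (rule form)
  have Sre: "Re (?S (w m) (w m) v) \<ge> 0" for m v by (rule psd_form_nonneg[OF choi])
  \<comment> \<open>The negated claim amounts to this inclusion of null vectors, because
    \<open>A v v\<close> is a sum of nonnegative terms.\<close>
  have AC: "C v v = 0" if "A v v = 0" for v
  proof -
    have "(\<Sum>m<M. Re (?S (w m) (w m) v)) = 0" using that by (simp add: A_def flip: Re_sum)
    then have "Re (?S (w m) (w m) v) = 0" if "m < M" for m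
      using Sre that by (subst (asm) sum_nonneg_eq_0_iff) auto
    then have "?S (w m) (w m) v = 0" if "m < M" for m
      using that psd_form_real[OF choi] by (simp add: complex_eq_iff)
    then show ?thesis using neg by (auto simp: C_def)
  qed
  obtain c where c: "c \<ge> 0" and
    dom: "\<And>v. \<forall>i\<ge>d. v i = 0 \<Longrightarrow> Re (C v v) \<le> c * Re (A v v)"
    using psd_form_dominated[OF Aform Cform AC, of d] by blast
  \<comment> \<open>Both forms read only coordinates below \<open>d\<close>, so truncating
    \<open>v\<close> removes the support condition.\<close>
  have dom: "Re (C v v) \<le> c * Re (A v v)" for v
  proof -
    let ?v = "\<lambda>i. if i < d then v i else 0"
    have "C v v = C ?v ?v" "A v v = A ?v ?v"
      unfolding C_def A_def by (auto intro!: sum.cong choi_tens_cong)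
    moreover have "Re (C ?v ?v) \<le> c * Re (A ?v ?v)" by (rule dom) simp
    ultimately show ?thesis by simp
  qed
  \<comment> \<open>With \<open>e * (1 + c) = 1\<close>, the cross terms, which are at least
    \<open>-(1 + c) A\<close>, are exactly compensated by \<open>A\<close> after scaling by
    \<open>e\<close>.\<close>
  define e where "e = 1 / (1 + c)"
  have e: "e > 0" "e * (1 + c) = 1" using c by (simp_all add: e_def)
  define p where "p = w m0"
  define P where "P = (\<lambda>i j. \<Sum>m<M. w m i * cnj (w m j))"
  \<comment> \<open>\<open>R\<close> is a sum of outer products of \<open>f m\<close>, which is
    \<open>w m\<close> in the qubit state 0 plus, for \<open>m = m0\<close>, \<open>e u\<close> in
    state 1, and of \<open>g m\<close>, which is \<open>w m\<close> in state 1. Positivity is then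
    immediate.\<close>
  define f where "f = (\<lambda>m i k. of_bool (k = (0::nat)) * w m i + of_bool (k = 1 \<and> m = m0) * (of_real e * u i))"
  define g where "g = (\<lambda>m i k. of_bool (k = (1::nat)) * w m i)"
  define R where "R = (\<lambda>i k j l. (\<Sum>m<M. f m i k * cnj (f m j l)) + (\<Sum>m<M. g m i k * cnj (g m j l)))"
  have R00: "R i 0 j 0 = P i j" for i j
    by (simp add: R_def f_def g_def P_def)
  have R01: "R i 0 j (Suc 0) = of_real e * (p i * cnj (u j))" for i j
  proof -
    have "(\<Sum>m<M. f m i (0) * cnj (f m j ((Suc 0)))) = (\<Sum>m<M. if m = m0 then of_real e * (p i * cnj (u j)) else 0)"
      by (intro sum.cong) (auto simp: f_def p_def)
    then show ?thesis using m0 by (simp add: R_def g_def)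
  qed
  have R10: "R i (Suc 0) j 0 = of_real e * (u i * cnj (p j))" for i j
  proof -
    have "(\<Sum>m<M. f m i ((Suc 0)) * cnj (f m j (0))) = (\<Sum>m<M. if m = m0 then of_real e * (u i * cnj (p j)) else 0)"
      by (intro sum.cong) (auto simp: f_def p_def)
    then show ?thesis using m0 by (simp add: R_def g_def)
  qed
  have R11: "R i (Suc 0) j (Suc 0) = P i j + of_real (e\<^sup>2) * (u i * cnj (u j))" for i j
  proof -
    have "(\<Sum>m<M. f m i (Suc 0) * cnj (f m j (Suc 0))) = (\<Sum>m<M. if m = m0 then of_real (e\<^sup>2) * (u i * cnj (u j)) else 0)"
      by (intro sum.cong) (auto simp: f_def power2_eq_square)
    then show ?thesis using m0 by (simp add: R_def g_def P_def)
  qed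
  have dpos: "d > 0" using u0 by (auto intro: Nat.gr0I)
  have Rpsd: "psd_kernel (d*2) (\<lambda>r c. R (r div 2) (r mod 2) (c div 2) (c mod 2))"
    unfolding R_def by (intro psd_kernel_add psd_kernel_sum psd_kernel_outer)
  obtain t \<rho> where t: "t \<ge> 0" and \<rho>: "density (d*2) \<rho>" and
    R\<rho>: "\<And>r c. r < d*2 \<Longrightarrow> c < d*2 \<Longrightarrow> R (r div 2) (r mod 2) (c div 2) (c mod 2) = of_real t * \<rho> $$ (r,c)"
    by (rule psd_kernel_normalise[OF Rpsd]) (use dpos in auto)
  have quad01: "quad d (\<lambda>i j. R i 0 j 1) p u \<noteq> 0"
  proof -
    have "quad d (\<lambda>i j. R i 0 j 1) p u = of_real e * ((\<Sum>i<d. cnj (p i) * p i) * cnj (\<Sum>i<d. cnj (u i) * u i))"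
      by (simp add: R01 quad_scale quad_outer)
    then show ?thesis using e u0 p0 by (simp add: p_def del: cnj_sum)
  qed
  \<comment> \<open>Weight 0 would erase the off-diagonal block, contradicting
    \<open>quad01\<close>.\<close>
  have t0: "t \<noteq> 0"
  proof
    assume "t = 0"
    have "R i 0 j 1 = 0" if "i < d" "j < d" for i j
    proof -
      have "Suc (j*2) mod 2 = Suc 0" by presburger
      then show ?thesis
        using R\<rho>[of "i*2" "Suc (j*2)"] mult_add_less[of i d 0 2] mult_add_less[of j d 1 2] that \<open>t = 0\<close>
        by simp
    qed
    then have "quad d (\<lambda>i j. R i 0 j 1) p u = 0" by (simp add: quad_def)
    with quad01 show False ..
  qed
  define s where "s = 1 / t"
  have s: "s > 0" using t t0 by (simp add: s_def)
  have "\<rho> \<in> carrier_mat (d*2) (d*2)" using \<rho> by (simp add: density_def psd_iff)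
  then have \<rho>bip: "\<rho> = bip d 2 (\<lambda>i k j l. of_real s * R i k j l)"
    using R\<rho> t0 unfolding bip_def by (intro eq_matI) (auto simp: s_def)
  have "\<not> separable d 2 \<rho>"
    unfolding \<rho>bip
  proof (rule not_separable_bip)
    have "quad d P u u = 0"
      unfolding P_def quad_sum quad_outer using orth by simp
    then show "quad d (\<lambda>i j. of_real s * R i 0 j 0) u u = 0"
      by (simp add: R00 quad_scale)
    show "quad d (\<lambda>i j. of_real s * R i 0 j 1) p u \<noteq> 0"
      using quad01 s by (simp add: quad_scale)
  qed auto
  with \<rho> have "entangled d 2 \<rho>" by (simp add: entangled_def)
  then have "entangled d 2 (ext_id \<phi> d 2 \<rho>)" using uep by (simp add: UEP_def)
  moreover define R' where "R' = (\<lambda>i k j l. map_kernel d \<phi> (\<lambda>p q. of_real s * R p k q l) i j)"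
  have img: "ext_id \<phi> d 2 \<rho> = bip d 2 R'"
    unfolding \<rho>bip R'_def by (rule ext_id_bip[OF lin])
  ultimately have tr: "mtrace (bip d 2 R') = 1" and nsep: "\<not> separable d 2 (bip d 2 R')"
    by (simp_all add: entangled_def density_def)
  define LP where "LP = map_kernel d \<phi> P"
  define LX where "LX = map_kernel d \<phi> (\<lambda>i j. p i * cnj (u j))"
  define LY where "LY = map_kernel d \<phi> (\<lambda>i j. u i * cnj (p j))"
  define LU where "LU = map_kernel d \<phi> (\<lambda>i j. u i * cnj (u j))"
  \<comment> \<open>The first four terms average over the powers of \<open>\<i>\<close>: the sums of
    \<open>\<i>^n\<close> and of its square vanish, so \<open>LX\<close> and \<open>LY\<close>
    survive only in their own off-diagonal blocks. The fifth term adds \<open>e\<^sup>2 LU\<close>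
    to the block (1,1).\<close>
  define a where "a = (\<lambda>n i j. if n < (4::nat)
      then of_real (s / 4) * (LP i j + of_real e * (cnj (\<i>^n) * LX i j + \<i>^n * LY i j))
      else of_real (s * e\<^sup>2) * LU i j)"
  define b where "b = (\<lambda>n k l. if n < (4::nat)
      then (if k = (0::nat) then 1 else cnj (\<i>^n)) * cnj (if l = (0::nat) then 1 else cnj (\<i>^n))
      else of_bool (k = 1) * cnj (of_bool (l = 1)))"
  have LPA: "quad d LP v v = A v v" for v
  proof -
    have "LP = (\<lambda>i j. \<Sum>m<M. map_kernel d \<phi> (\<lambda>i j. w m i * cnj (w m j)) i j)"
      unfolding LP_def P_def by (intro ext map_kernel_sum)
    then show ?thesis by (simp add: quad_sum A_def choi_tens)
  qed
  have "psd_kernel d (a n)" if "n < 5" for n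
  proof (cases "n < 4")
    case True
    define al where "al = \<i>^n"
    have al: "cmod al = 1" by (simp add: al_def norm_power)
    have "psd_kernel d (\<lambda>i j. LP i j + of_real e * (cnj al * LX i j + al * LY i j))"
      unfolding psd_kernel_def
    proof (intro allI)
      fix v
      define q where "q = cnj al * ?S p u v + al * ?S u p v"
      have exp: "quad d (\<lambda>i j. LP i j + of_real e * (cnj al * LX i j + al * LY i j)) v v = A v v + of_real e * q"
        by (simp add: quad_add quad_scale LPA q_def choi_tens LX_def LY_def)
      \<comment> \<open>Completing the square: as \<open>al\<close> has modulus 1, the cross terms
        \<open>q\<close> are the form at \<open>?z\<close> minus its values at \<open>p\<close> and
        \<open>u\<close>.\<close>
      let ?z = "\<lambda>r. tens d v p r + cnj al * tens d v u r"
      have q: "q = choi d \<phi> ?z ?z - ?S p p v - ?S u u v"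
        unfolding psd_form_expand[OF choi] q_def using al by simp
      \<comment> \<open>\<open>p\<close> is one of the \<open>w m\<close>, so its term is at most
        the whole sum \<open>A\<close>.\<close>
      have "Re (?S p p v) \<le> (\<Sum>m<M. Re (?S (w m) (w m) v))"
        unfolding p_def using m0 by (intro member_le_sum Sre) auto
      then have "Re (?S p p v) \<le> Re (A v v)" by (simp add: A_def)
      moreover have "Re (?S u u v) \<le> c * Re (A v v)" using dom[of v] by (simp add: C_def)
      moreover have "0 \<le> Re (choi d \<phi> ?z ?z)" by (rule psd_form_nonneg[OF choi])
      ultimately have "- (1 + c) * Re (A v v) \<le> Re q" by (simp add: q algebra_simps)
      then have "e * (- (1 + c) * Re (A v v)) \<le> e * Re q" using e(1) by (intro mult_left_mono) auto
      also have "e * (- (1 + c) * Re (A v v)) = - (e * (1 + c)) * Re (A v v)" by (simp add: algebra_simps)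
      finally have "0 \<le> Re (A v v) + e * Re q" by (simp add: e(2))
      moreover have "Im q = 0" "Im (A v v) = 0"
        unfolding q using psd_form_real[OF choi] psd_form_real[OF Aform] by simp_all
      ultimately show "Im (quad d (\<lambda>i j. LP i j + of_real e * (cnj al * LX i j + al * LY i j)) v v) = 0 \<and>
          0 \<le> Re (quad d (\<lambda>i j. LP i j + of_real e * (cnj al * LX i j + al * LY i j)) v v)"
        unfolding exp by simp
    qed
    from psd_kernel_scale[OF this, of "s / 4"] show ?thesis
      using True s by (simp add: a_def al_def)
  next
    case False
    have "psd_kernel d LU"
      unfolding psd_kernel_def LU_def choi_tens[symmetric]
      using psd_form_real[OF choi] psd_form_nonneg[OF choi] by simp
    from psd_kernel_scale[OF this, of "s * e\<^sup>2"] show ?thesis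
      using False s by (simp add: a_def)
  qed
  moreover have "psd_kernel 2 (b n)" for n
    by (cases "n < 4") (simp_all only: b_def if_True if_False psd_kernel_outer)
  moreover have "R' i k j l = (\<Sum>n<5. a n i j * b n k l)" if "i < d" "j < d" "k < 2" "l < 2" for i j k l
  proof -
    have "k = 0 \<or> k = 1" "l = 0 \<or> l = 1" using that by auto
    moreover have i3: "\<i> ^ 3 = - \<i>" by (simp add: eval_nat_numeral)
    ultimately show ?thesis
      unfolding R'_def
      by (elim disjE) (simp_all add: R00 R01 R10 R11 map_kernel_scale map_kernel_add
          flip: LP_def LX_def LY_def LU_def,
        simp_all add: a_def b_def eval_nat_numeral field_simps)
  qed
  ultimately have "separable d 2 (bip d 2 R')"
    by (intro separable_bipI[where N = 5] tr)
  with nsep show False ..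
qed

text \<open>\<open>d \<ge> 2\<close> supplies a nonzero vector orthogonal to \<open>u\<close> in
  both uses of \<open>UEP_separating_vector\<close>.\<close>

lemma UEP_imp_unitary_conj:
  assumes ch: "quantum_channel d \<phi>" and uep: "UEP d \<phi>" and d: "d \<ge> 2"
  shows "\<exists>U. unitary d U \<and> (\<forall>X \<in> carrier_mat d d. \<phi> X = U * X * adj U)"
proof -
  have lin: "linear_map_on d \<phi>" and tp: "trace_preserving d \<phi>"
    using ch by (auto simp: quantum_channel_def)
  note choi = psd_form_choi[OF ch]
  have sum_unit: "(\<Sum>i<d. unit_fun k i * f i) = f k" if "k < d" for k f
  proof -
    have "(\<Sum>i<d. unit_fun k i * f i) = (\<Sum>i<d. if i = k then f k else 0)"
      by (intro sum.cong) (auto simp: unit_fun_def)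
    then show ?thesis using that by simp
  qed
  have cnj_unit: "cnj (unit_fun k i) = unit_fun k i" for k i by (simp add: unit_fun_def)
  have "\<exists>v. (\<forall>k<d. k \<noteq> j \<longrightarrow> choi d \<phi> (tens d v (unit_fun k)) (tens d v (unit_fun k)) = 0) \<and>
      choi d \<phi> (tens d v (unit_fun j)) (tens d v (unit_fun j)) \<noteq> 0" if j: "j < d" for j
  proof -
    \<comment> \<open>The zero vector at index \<open>j\<close> keeps the family indexed by all
      \<open>m < d\<close> and orthogonal to \<open>unit_fun j\<close>; \<open>?m0\<close> is any
      index other than \<open>j\<close>.\<close>
    let ?w = "\<lambda>m. if m = j then (\<lambda>_. 0) else unit_fun m"
    let ?m0 = "if j = 0 then 1 else 0 :: nat"
    have "\<exists>v. (\<forall>m<d. choi d \<phi> (tens d v (?w m)) (tens d v (?w m)) = 0) \<and>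
        choi d \<phi> (tens d v (unit_fun j)) (tens d v (unit_fun j)) \<noteq> 0"
      by (rule UEP_separating_vector[OF ch uep, where ?m0.0 = ?m0])
        (use d j in \<open>auto simp: cnj_unit sum_unit, auto simp: unit_fun_def\<close>)
    then obtain v where v: "\<forall>m<d. choi d \<phi> (tens d v (?w m)) (tens d v (?w m)) = 0"
        "choi d \<phi> (tens d v (unit_fun j)) (tens d v (unit_fun j)) \<noteq> 0"
      by blast
    have "choi d \<phi> (tens d v (unit_fun k)) (tens d v (unit_fun k)) = 0" if "k < d" "k \<noteq> j" for k
      using v(1)[rule_format, OF that(1)] that(2) by simp
    then show ?thesis using v(2) by blast
  qed
  then obtain V where
    V0: "\<And>j k. j < d \<Longrightarrow> k < d \<Longrightarrow> k \<noteq> j \<Longrightarrow>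
      choi d \<phi> (tens d (V j) (unit_fun k)) (tens d (V j) (unit_fun k)) = 0" and
    V1: "\<And>j. j < d \<Longrightarrow> choi d \<phi> (tens d (V j) (unit_fun j)) (tens d (V j) (unit_fun j)) \<noteq> 0"
    by metis
  define g where "g = (\<lambda>p q. choi d \<phi> (tens d (V p) (unit_fun p)) (tens d (V q) (unit_fun q)))"
  have coll: "(\<Sum>a<d. c a * f a) = c k * f k" if "k < d" "\<And>a. a < d \<Longrightarrow> a \<noteq> k \<Longrightarrow> f a = 0" for c f :: "nat \<Rightarrow> complex" and k
  proof -
    have "(\<Sum>a<d. c a * f a) = (\<Sum>a<d. if a = k then c k * f k else 0)"
      using that by (intro sum.cong) auto
    then show ?thesis using that by simp
  qed
  \<comment> \<open>By \<open>V0\<close> the vectors \<open>V a \<otimes> e\<^sub>k\<close> with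
    \<open>a \<noteq> k\<close> are null and drop out of the expansion.\<close>
  have left: "choi d \<phi> (tens d (\<lambda>i. \<Sum>a<d. c a * V a i) (unit_fun k)) z
      = cnj (c k) * choi d \<phi> (tens d (V k) (unit_fun k)) z" if "k < d" for c k z
    unfolding tens_sum_left psd_form_sum_left[OF choi finite_lessThan]
    by (rule coll[OF that]) (use V0 that psd_form_null_left[OF choi] in auto)
  have right: "choi d \<phi> z (tens d (\<lambda>i. \<Sum>a<d. c a * V a i) (unit_fun k))
      = c k * choi d \<phi> z (tens d (V k) (unit_fun k))" if "k < d" for c k z
    unfolding tens_sum_left psd_form_sum_right[OF choi finite_lessThan]
    by (rule coll[OF that]) (use V0 that psd_form_null_right[OF choi] in auto)
  define W where "W = mat d d (\<lambda>(i,j). V j i)"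
  have W: "W \<in> carrier_mat d d" by (simp add: W_def)
  \<comment> \<open>Pairing a linear relation among the \<open>V a\<close> with
    \<open>V k \<otimes> e\<^sub>k\<close> isolates its \<open>k\<close>-th coefficient, since
    \<open>g k k \<noteq> 0\<close>.\<close>
  have "det W \<noteq> 0"
  proof
    assume "det W = 0"
    then obtain x where x: "x \<in> carrier_vec d" "x \<noteq> 0\<^sub>v d" "W *\<^sub>v x = 0\<^sub>v d"
      using det_0_iff_vec_prod_zero[OF W] by blast
    have z: "(\<Sum>a<d. x $ a * V a i) = 0" if "i < d" for i
    proof -
      have "(W *\<^sub>v x) $ i = (\<Sum>a<d. x $ a * V a i)"
        using that x(1) by (auto simp: W_def scalar_prod_def atLeast0LessThan mult.commute intro!: sum.cong)
      then show ?thesis using x(3) that by simp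
    qed
    have "x $ k = 0" if k: "k < d" for k
    proof -
      let ?z = "tens d (V k) (unit_fun k)"
      have "x $ k * g k k = choi d \<phi> ?z (tens d (\<lambda>i. \<Sum>a<d. x $ a * V a i) (unit_fun k))"
        unfolding right[OF k] g_def ..
      also have "\<dots> = choi d \<phi> ?z (tens d (\<lambda>i. 0 * V k i) (unit_fun k))"
        by (rule choi_tens_cong) (simp_all add: z)
      also have "\<dots> = 0" unfolding tens_scale_left psd_form_scale_right[OF choi] by simp
      finally show ?thesis using V1[OF k] by (simp add: g_def)
    qed
    then have "x = 0\<^sub>v d" using x(1) by (intro eq_vecI) auto
    with x(2) show False ..
  qed
  then obtain Mi where Mi: "Mi \<in> carrier_mat d d" "W * Mi = 1\<^sub>m d"
    using det_non_zero_imp_unit[OF W, where b="()"] by (auto simp: Units_def ring_mat_def)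
  \<comment> \<open>Column \<open>i\<close> of the inverse holds the coordinates of
    \<open>unit_fun i\<close> in the basis \<open>V\<close>.\<close>
  define M where "M = (\<lambda>a i. Mi $$ (a,i))"
  have unit_V: "unit_fun i k = (\<Sum>a<d. M a i * V a k)" if "i < d" "k < d" for i k
  proof -
    have "(W * Mi) $$ (k,i) = (\<Sum>a<d. M a i * V a k)"
      using that Mi(1) by (auto simp: W_def M_def scalar_prod_def atLeast0LessThan mult.commute intro!: sum.cong)
    then show ?thesis using that by (auto simp: Mi(2) unit_fun_def)
  qed
  have entry: "map_entry d \<phi> p q i j = cnj (M p i) * M q j * g p q"
    if "p < d" "q < d" "i < d" "j < d" for p q i j
  proof -
    have "map_entry d \<phi> p q i j = quad d (map_kernel d \<phi> (\<lambda>a b. unit_fun p a * cnj (unit_fun q b))) (unit_fun i) (unit_fun j)"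
      using that by (simp add: quad_unit_fun map_kernel_unit_fun)
    also have "\<dots> = choi d \<phi> (tens d (unit_fun i) (unit_fun p)) (tens d (unit_fun j) (unit_fun q))"
      by (rule choi_tens[symmetric])
    also have "\<dots> = choi d \<phi> (tens d (\<lambda>k. \<Sum>a<d. M a i * V a k) (unit_fun p))
        (tens d (\<lambda>k. \<Sum>a<d. M a j * V a k) (unit_fun q))"
      using that by (intro choi_tens_cong) (auto simp: unit_V)
    also have "\<dots> = cnj (M p i) * M q j * g p q"
      using that by (simp add: left right g_def)
    finally show ?thesis .
  qed
  \<comment> \<open>These vectors are orthogonal to the all-ones vector; index 0 gives zero, and
    index 1 serves as the nonzero member.\<close>
  let ?w = "\<lambda>m i. unit_fun 0 i + (-1) * unit_fun m i"
  have "\<exists>v. (\<forall>m<d. choi d \<phi> (tens d v (?w m)) (tens d v (?w m)) = 0) \<and>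
      choi d \<phi> (tens d v (\<lambda>_. 1)) (tens d v (\<lambda>_. 1)) \<noteq> 0"
  proof (rule UEP_separating_vector[OF ch uep])
    show "(\<Sum>i<d. cnj 1 * ?w m i) = 0" if "m < d" for m
      using sum_unit[of 0 "\<lambda>_. 1"] sum_unit[of m "\<lambda>_. 1"] that d
      by (simp add: sum_subtractf)
    show "1 < d" using d by simp
    have "(\<Sum>i<d. cnj (?w 1 i) * ?w 1 i) = (\<Sum>i<d. unit_fun 0 i * 1) + (\<Sum>i<d. unit_fun 1 i * 1)"
      unfolding sum.distrib[symmetric] by (intro sum.cong) (auto simp: unit_fun_def)
    also have "\<dots> = 1 + 1" using d by (subst (1 2) sum_unit) auto
    finally show "(\<Sum>i<d. cnj (?w 1 i) * ?w 1 i) \<noteq> 0" by simp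
    show "(\<Sum>i<d. cnj 1 * 1) \<noteq> (0::complex)" using d by simp
  qed
  then obtain v where v0: "\<And>m. m < d \<Longrightarrow> choi d \<phi> (tens d v (?w m)) (tens d v (?w m)) = 0"
    and v1: "choi d \<phi> (tens d v (\<lambda>_. 1)) (tens d v (\<lambda>_. 1)) \<noteq> 0" by blast
  define y where "y = (\<lambda>a. \<Sum>i<d. M a i * v i)"
  have v_V: "v k = (\<Sum>a<d. y a * V a k)" if "k < d" for k
  proof -
    have "v k = (\<Sum>i<d. v i * unit_fun k i)" using sum_unit[OF that, of v] by (simp add: mult.commute)
    also have "\<dots> = (\<Sum>i<d. v i * unit_fun i k)" by (intro sum.cong) (auto simp: unit_fun_def)
    also have "\<dots> = (\<Sum>i<d. \<Sum>a<d. v i * M a i * V a k)"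
      using that by (intro sum.cong refl) (simp add: unit_V sum_distrib_left mult.assoc)
    also have "\<dots> = (\<Sum>a<d. \<Sum>i<d. v i * M a i * V a k)" by (rule sum.swap)
    finally show ?thesis unfolding y_def sum_distrib_right by (simp only: mult.commute)
  qed
  have vk: "choi d \<phi> (tens d v (unit_fun k)) (tens d w x) = cnj (y k) * choi d \<phi> (tens d (V k) (unit_fun k)) (tens d w x)"
    if "k < d" for k w x
  proof -
    have "choi d \<phi> (tens d v (unit_fun k)) (tens d w x)
        = choi d \<phi> (tens d (\<lambda>i. \<Sum>a<d. y a * V a i) (unit_fun k)) (tens d w x)"
      by (rule choi_tens_cong) (auto simp: v_V)
    then show ?thesis by (simp add: left[OF that])
  qed
  have kv: "choi d \<phi> z (tens d v (unit_fun k)) = y k * choi d \<phi> z (tens d (V k) (unit_fun k))"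
    if "k < d" "z = tens d w x" for k z w x
  proof -
    have "choi d \<phi> z (tens d v (unit_fun k))
        = choi d \<phi> z (tens d (\<lambda>i. \<Sum>a<d. y a * V a i) (unit_fun k))"
      unfolding that(2) by (rule choi_tens_cong) (auto simp: v_V)
    then show ?thesis by (simp add: right[OF that(1)])
  qed
  \<comment> \<open>The form cannot distinguish \<open>v \<otimes> e\<^sub>k\<close> from
    \<open>v \<otimes> e\<^sub>0\<close>, because their difference is null.\<close>
  have row: "cnj (y k) * g k l = cnj (y 0) * g 0 l" if "k < d" "l < d" for k l
  proof -
    let ?z = "tens d (V l) (unit_fun l)"
    have "choi d \<phi> (tens d v (?w k)) ?z = 0"
      by (rule psd_form_null_left[OF choi v0[OF that(1)]])
    then have "choi d \<phi> (tens d v (unit_fun 0)) ?z = choi d \<phi> (tens d v (unit_fun k)) ?z"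
      unfolding tens_add_right tens_scale_right psd_form_add_left[OF choi] psd_form_scale_left[OF choi]
      by simp
    then show ?thesis using that d by (simp add: vk g_def)
  qed
  \<comment> \<open>The common value of all \<open>cnj (y k) * g k l * y l\<close>; its existence
    means that \<open>g\<close> has rank at most one.\<close>
  define \<kappa> where "\<kappa> = (cmod (y 0))\<^sup>2 * Re (g 0 0)"
  have g00: "g 0 0 = of_real (Re (g 0 0))" unfolding g_def by (rule psd_form_eq_Re[OF choi])
  have g00cnj: "cnj (g 0 0) = g 0 0" unfolding g_def by (rule psd_form_herm[OF choi, symmetric])
  have \<kappa>nn: "\<kappa> \<ge> 0" unfolding \<kappa>_def g_def using psd_form_nonneg[OF choi] by simp
  have \<kappa>: "cnj (y k) * g k l * y l = of_real \<kappa>" if "k < d" "l < d" for k l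
  proof -
    have herm: "g 0 l = cnj (g l 0)" unfolding g_def by (rule psd_form_herm[OF choi])
    have "cnj (y k) * g k l * y l = cnj (y 0) * g 0 l * y l" using row[OF that] by simp
    also have "\<dots> = cnj (y 0 * (cnj (y l) * g l 0))" by (simp add: herm mult_ac)
    also have "\<dots> = cnj (y 0 * (cnj (y 0) * g 0 0))" using row[of l 0] that d by simp
    also have "\<dots> = of_real \<kappa>"
      unfolding \<kappa>_def of_real_mult complex_norm_square g00[symmetric] by (simp add: g00cnj mult_ac)
    finally show ?thesis .
  qed
  \<comment> \<open>The form at \<open>v\<close> tensored with the all-ones vector is a sum of
    copies of \<open>\<kappa>\<close>, and \<open>v1\<close> says that it is nonzero.\<close>
  have \<kappa>0: "\<kappa> \<noteq> 0"
  proof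
    assume "\<kappa> = 0"
    have one: "(\<Sum>k<d. 1 * unit_fun k i) = 1" if "i < d" for i
    proof -
      have "(\<Sum>k<d. 1 * unit_fun k i) = (\<Sum>k<d. unit_fun i k * 1)"
        by (intro sum.cong) (auto simp: unit_fun_def)
      then show ?thesis using sum_unit[OF that, of "\<lambda>_. 1"] by simp
    qed
    have "choi d \<phi> (tens d v (\<lambda>_. 1)) (tens d v (\<lambda>_. 1))
        = choi d \<phi> (tens d v (\<lambda>i. \<Sum>k<d. 1 * unit_fun k i)) (tens d v (\<lambda>i. \<Sum>k<d. 1 * unit_fun k i))"
      by (rule choi_tens_cong) (simp_all only: one)
    also have "\<dots> = (\<Sum>k<d. \<Sum>l<d. choi d \<phi> (tens d v (unit_fun k)) (tens d v (unit_fun l)))"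
      unfolding tens_sum_right psd_form_sum_left[OF choi finite_lessThan] psd_form_sum_right[OF choi finite_lessThan]
      by simp
    also have "\<dots> = (\<Sum>k<d. \<Sum>l<d. of_real \<kappa>)"
    proof (intro sum.cong refl)
      fix k l assume "k \<in> {..<d}" "l \<in> {..<d}"
      then show "choi d \<phi> (tens d v (unit_fun k)) (tens d v (unit_fun l)) = of_real \<kappa>"
        using \<kappa>[of k l] by (simp add: vk kv[OF _ refl] g_def mult_ac)
    qed
    finally show False using v1 \<open>\<kappa> = 0\<close> by simp
  qed
  have y0: "y k \<noteq> 0" if "k < d" for k using \<kappa>[OF that that] \<kappa>0 by auto
  \<comment> \<open>The Kraus operator: in \<open>entry\<close>,
    \<open>g p q = \<kappa> / (cnj (y p) * y q)\<close> factors into a \<open>p\<close> part and a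
    \<open>q\<close> part, each taking \<open>sqrt \<kappa>\<close>.\<close>
  define K where "K = mat d d (\<lambda>(i,p). cnj (M p i) * of_real (sqrt \<kappa>) / cnj (y p))"
  have K: "K \<in> carrier_mat d d" by (simp add: K_def)
  have KK: "K $$ (i,p) * cnj (K $$ (j,q)) = map_entry d \<phi> p q i j"
    if "p < d" "q < d" "i < d" "j < d" for p q i j
  proof -
    have "g p q = of_real \<kappa> / (cnj (y p) * y q)"
      using \<kappa>[OF that(1,2)] y0 that by (simp add: field_simps)
    moreover have "complex_of_real (sqrt \<kappa>) * of_real (sqrt \<kappa>) = of_real \<kappa>"
      using \<kappa>nn by (simp flip: of_real_mult)
    ultimately show ?thesis using that by (simp add: K_def entry)
  qed
  have "adj K * K = 1\<^sub>m d"
  proof (rule eq_matI)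
    fix q p assume "q < dim_row (1\<^sub>m d :: complex mat)" "p < dim_col (1\<^sub>m d :: complex mat)"
    then have pq: "p < d" "q < d" by simp_all
    have "(adj K * K) $$ (q,p) = (\<Sum>i<d. cnj (K $$ (i,q)) * K $$ (i,p))"
      using K adj_carrier[OF K] pq adj_index[OF K]
      by (auto simp: scalar_prod_def atLeast0LessThan intro!: sum.cong)
    \<comment> \<open>The entry is the trace of the image of a matrix unit, so trace preservation
      makes \<open>K\<close> unitary.\<close>
    also have "\<dots> = (\<Sum>i<d. map_kernel d \<phi> (\<lambda>a b. unit_fun p a * cnj (unit_fun q b)) i i)"
      using pq by (intro sum.cong refl) (simp add: map_kernel_unit_fun KK[symmetric])
    also have "\<dots> = (\<Sum>i<d. unit_fun p i * cnj (unit_fun q i))"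
      by (rule map_kernel_trace[OF lin tp])
    also have "\<dots> = unit_fun q p" unfolding cnj_unit by (rule sum_unit[OF pq(1)])
    finally show "(adj K * K) $$ (q,p) = 1\<^sub>m d $$ (q,p)"
      using pq by (auto simp: unit_fun_def)
  qed (use K adj_carrier[OF K] in auto)
  then have "unitary d K" using K by (simp add: unitary_def)
  moreover have "\<phi> X = K * X * adj K" if X: "X \<in> carrier_mat d d" for X
  proof (rule eq_matI)
    have \<phi>X: "\<phi> X \<in> carrier_mat d d" using lin X by (simp add: linear_map_on_def)
    then show "dim_row (\<phi> X) = dim_row (K * X * adj K)" "dim_col (\<phi> X) = dim_col (K * X * adj K)"
      using K adj_carrier[OF K] by auto
    fix i j assume "i < dim_row (K * X * adj K)" "j < dim_col (K * X * adj K)"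
    then have ij: "i < d" "j < d" using K adj_carrier[OF K] by auto
    have "X = mat d d (\<lambda>(i,j). X $$ (i,j))" using X by (intro eq_matI) auto
    then have "\<phi> X $$ (i,j) = \<phi> (mat d d (\<lambda>(i,j). X $$ (i,j))) $$ (i,j)" by (rule arg_cong)
    also have "\<dots> = map_kernel d \<phi> (\<lambda>p q. X $$ (p,q)) i j"
      by (rule map_kernel_index[OF lin ij, symmetric])
    also have "\<dots> = (K * X * adj K) $$ (i,j)"
      unfolding conj_index[OF K X ij] map_kernel_def using ij
      by (intro sum.cong refl) (simp add: KK[symmetric] mult_ac)
    finally show "\<phi> X $$ (i,j) = (K * X * adj K) $$ (i,j)" .
  qed
  ultimately show ?thesis by blast
qed

section \<open>The equivalence in every dimension\<close>

lemma unitary_one: "unitary d (1\<^sub>m d)" and adj_one: "adj (1\<^sub>m d) = 1\<^sub>m d"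
proof -
  show *: "adj (1\<^sub>m d) = 1\<^sub>m d" by (rule eq_matI) (auto simp: adj_def)
  show "unitary d (1\<^sub>m d)" by (simp add: unitary_def *)
qed

theorem mainTheorem3:
  fixes d :: nat and \<phi> :: "complex mat \<Rightarrow> complex mat"
  assumes "quantum_channel d \<phi>"
  shows "UEP d \<phi> \<longleftrightarrow> (\<exists>U. unitary d U \<and> (\<forall>X \<in> carrier_mat d d. \<phi> X = U * X * adj U))"
proof
  assume uep: "UEP d \<phi>"
  show "\<exists>U. unitary d U \<and> (\<forall>X \<in> carrier_mat d d. \<phi> X = U * X * adj U)"
  proof (cases "d \<ge> 2")
    case True
    then show ?thesis by (rule UEP_imp_unitary_conj[OF assms uep])
  next
    case False
    \<comment> \<open>For \<open>d \<le> 1\<close> a matrix has at most one entry, its trace, so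
      \<open>\<phi>\<close> acts as the identity.\<close>
    have "\<phi> X = 1\<^sub>m d * X * adj (1\<^sub>m d)" if X: "X \<in> carrier_mat d d" for X
    proof -
      have \<phi>X: "\<phi> X \<in> carrier_mat d d" and tr: "mtrace (\<phi> X) = mtrace X"
        using assms X by (auto simp: quantum_channel_def linear_map_on_def trace_preserving_def)
      have "\<phi> X = X"
      proof (rule eq_matI)
        fix i j assume "i < dim_row X" "j < dim_col X"
        then have "d = 1" "i = 0" "j = 0" using X False by auto
        then show "\<phi> X $$ (i,j) = X $$ (i,j)" using tr X \<phi>X by (simp add: mtrace_def)
      qed (use X \<phi>X in auto)
      then show ?thesis using X by (simp add: adj_one)
    qed
    then show ?thesis using unitary_one by blast
  qed
next
  assume "\<exists>U. unitary d U \<and> (\<forall>X \<in> carrier_mat d d. \<phi> X = U * X * adj U)"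
  then show "UEP d \<phi>" using unitary_conj_UEP[OF assms] by blast
qed

end
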